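(* Let $G$ be a graph on $n$ vertices with a clique $K_r$ such that deleting the vertices of $K_r$ leaves pairwise disjoint graphs $G_1,\dots,G_s$ with $s\ge 2$ (no edges between distinct $G_i$), and such that $d_G(K_r)=r(n-r)$, i.e. every vertex of $K_r$ is adjacent to every vertex outside $K_r$. Then for every $k=1,\dots,n-1$, $\alpha(G)=\alpha(F_k(G))=r$.
   Context: For an induced subgraph $G'=(V',E')$ of $G$, $d_G(G')$ is the number of edges between $V'$ and $V(G)\setminus V'$. $\alpha(G)$ is the algebraic connectivity, the second smallest eigenvalue of the Laplacian matrix. For a graph $G=(V,E)$ on $n$ vertices and $1\le k\le n-1$, the $k$-token graph $F_k(G)$ has as vertices the $k$-subsets of $V$, two $k$-subsets being adjacent iff their symmetric difference is $\{a,b\}$ with $ab\in E$. *)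

theory Defs
  imports
    "Graph_Theory.Graph_Theory"
    "Jordan_Normal_Form.Char_Poly"
begin

text \<open>Finite simple graphs are the \<^locale>\<open>pair_graph\<close>s: loop-free symmetric digraphs on a finite
  vertex set, an edge \<open>uv\<close> being represented by the two arcs \<open>(u,v)\<close> and \<open>(v,u)\<close>.\<close>

text \<open>Each edge with exactly one end in \<open>H\<close> is counted once, through the arc leaving \<open>H\<close>.\<close>

definition boundary_edges :: "'a pair_pre_digraph \<Rightarrow> 'a pair_pre_digraph \<Rightarrow> nat" where
  "boundary_edges G H =
     card {(u, v). (u, v) \<in> parcs G \<and> u \<in> pverts H \<and> v \<in> pverts G - pverts H}"

text \<open>The Laplacian matrix (degree matrix minus adjacency matrix), its rows and columns indexed
  along an enumeration \<open>vs\<close> of the vertices. In a symmetric digraph the out-degree is the degree.\<close>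

definition laplacian_mat :: "'a pair_pre_digraph \<Rightarrow> 'a list \<Rightarrow> real mat" where
  "laplacian_mat G vs = mat (length vs) (length vs) (\<lambda>(i, j).
     (if i = j then real (out_degree (with_proj G) (vs ! i)) else 0) -
     (if (vs ! i, vs ! j) \<in> parcs G then 1 else 0))"

text \<open>The eigenvalues in increasing order, each repeated according to its multiplicity as a root of
  the characteristic polynomial; by \<open>laplacian_spectrum_enum\<close> below, the enumeration chosen is
  immaterial.\<close>

definition laplacian_spectrum :: "'a pair_pre_digraph \<Rightarrow> real list" where
  "laplacian_spectrum G = sorted_list_of_multiset (proots (char_poly
     (laplacian_mat G (SOME vs. distinct vs \<and> set vs = pverts G))))"

text \<open>List indices start at \<open>0\<close>, so this is the second smallest eigenvalue.\<close>

definition algebraic_connectivity :: "'a pair_pre_digraph \<Rightarrow> real" where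
  "algebraic_connectivity G = laplacian_spectrum G ! 1"

definition token_graph :: "nat \<Rightarrow> 'a pair_pre_digraph \<Rightarrow> 'a set pair_pre_digraph" where
  "token_graph k G = \<lparr>
     pverts = {S. S \<subseteq> pverts G \<and> card S = k},
     parcs = {(S, T). S \<subseteq> pverts G \<and> card S = k \<and> T \<subseteq> pverts G \<and> card T = k \<and>
       (\<exists>a b. (S - T) \<union> (T - S) = {a, b} \<and> (a, b) \<in> parcs G)}\<rparr>"

lemma char_poly_laplacian_mat_enum:
  assumes "distinct vs" "distinct ws" "set vs = set ws"
  shows "char_poly (laplacian_mat G vs) = char_poly (laplacian_mat G ws)"
proof -
  define n where "n = length vs"
  have n': "length ws = n"
    using assms by (metis distinct_card n_def)
  define f where "f u v = (if u = v then real (out_degree (with_proj G) u) else 0) -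
     (if (u, v) \<in> parcs G then 1 else 0)" for u v
  have Lf: "laplacian_mat G us = mat (length us) (length us) (\<lambda>(i, j). f (us ! i) (us ! j))"
    if "distinct us" for us
    unfolding laplacian_mat_def f_def using that
    by (intro eq_matI) (auto simp: nth_eq_iff_index_eq)
  define P :: "'a list \<Rightarrow> 'a list \<Rightarrow> real mat"
    where "P us xs = mat n n (\<lambda>(i, j). if us ! i = xs ! j then 1 else 0)" for us xs
  have sum1: "(\<Sum>j = 0..<n. (if u = xs ! j then 1 else 0) * g (xs ! j)) = g u"
    if xs: "distinct xs" "length xs = n" "u \<in> set xs" for u :: 'a and xs and g :: "'a \<Rightarrow> real"
  proof -
    obtain m where m: "m < n" "u = xs ! m"
      using xs(2,3) unfolding in_set_conv_nth by blast
    have "(\<Sum>j = 0..<n. (if u = xs ! j then 1 else 0) * g (xs ! j)) =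
        (\<Sum>j = 0..<n. if m = j then g (xs ! j) else 0)"
      using m xs by (intro sum.cong) (auto simp: nth_eq_iff_index_eq)
    then show ?thesis using m by simp
  qed
  have mul: "P us xs * mat n n (\<lambda>(i, j). g (xs ! i) j) = mat n n (\<lambda>(i, j). g (us ! i) j)"
    if "distinct xs" "length xs = n" "length us = n" "set us = set xs"
    for us xs :: "'a list" and g :: "'a \<Rightarrow> nat \<Rightarrow> real"
  proof (intro eq_matI)
    fix i j assume "i < dim_row (mat n n (\<lambda>(i, j). g (us ! i) j))"
      "j < dim_col (mat n n (\<lambda>(i, j). g (us ! i) j))"
    then have ij: "i < n" "j < n" by auto
    have "us ! i \<in> set xs" using ij that(3) unfolding that(4)[symmetric] by simp
    from sum1[OF that(1,2) this, of "\<lambda>v. g v j"] ij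
    show "(P us xs * mat n n (\<lambda>(i, j). g (xs ! i) j)) $$ (i, j) =
        mat n n (\<lambda>(i, j). g (us ! i) j) $$ (i, j)"
      by (simp add: P_def scalar_prod_def)
  qed (auto simp: P_def)
  have inv: "P us xs * P xs us = 1\<^sub>m n"
    if "distinct us" "distinct xs" "length xs = n" "length us = n" "set us = set xs" for us xs
  proof -
    have "P us xs * P xs us = mat n n (\<lambda>(i, j). if us ! i = us ! j then 1 else 0)"
      using mul[of xs us "\<lambda>v j. if v = us ! j then 1 else 0"] that by (simp add: P_def)
    also have "\<dots> = 1\<^sub>m n"
      using that by (intro eq_matI) (auto simp: nth_eq_iff_index_eq)
    finally show ?thesis .
  qed
  let ?A = "laplacian_mat G vs" and ?B = "laplacian_mat G ws"
  have c: "?A \<in> carrier_mat n n" "?B \<in> carrier_mat n n" "P vs ws \<in> carrier_mat n n"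
    "P ws vs \<in> carrier_mat n n"
    using n' by (auto simp: laplacian_mat_def P_def n_def)
  have i1: "P vs ws * P ws vs = 1\<^sub>m n" and i2: "P ws vs * P vs ws = 1\<^sub>m n"
    by (rule inv; use assms n' n_def in auto)+
  have "P vs ws * ?B = mat n n (\<lambda>(i, j). f (vs ! i) (ws ! j))"
    unfolding Lf[OF assms(2)] n' by (rule mul) (use assms n' n_def in auto)
  also have "\<dots> = ?A * P vs ws"
  proof (intro eq_matI)
    fix i j assume "i < dim_row (?A * P vs ws)" "j < dim_col (?A * P vs ws)"
    then have ij: "i < n" "j < n" using c by auto
    have "ws ! j \<in> set vs" using ij n' unfolding assms(3) by simp
    from sum1[OF assms(1) n_def[symmetric] this, of "\<lambda>v. f (vs ! i) v"] ij
    show "mat n n (\<lambda>(i, j). f (vs ! i) (ws ! j)) $$ (i, j) = (?A * P vs ws) $$ (i, j)"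
      by (simp add: P_def scalar_prod_def Lf[OF assms(1)] n_def[symmetric] mult.commute
          eq_commute[of "ws ! j"])
  qed (use c in auto)
  finally have "P vs ws * ?B * P ws vs = ?A * (P vs ws * P ws vs)"
    using c by simp
  also have "\<dots> = ?A"
    unfolding i1 using c(1) by simp
  finally have "?A = P vs ws * ?B * P ws vs" ..
  then have "similar_mat ?A ?B"
    using c i1 i2 by (intro similar_matI[of _ _ "P vs ws" "P ws vs" n]) simp_all
  then show ?thesis by (rule char_poly_similar)
qed

lemma laplacian_spectrum_enum:
  assumes "distinct vs" "set vs = pverts G"
  shows "laplacian_spectrum G = sorted_list_of_multiset (proots (char_poly (laplacian_mat G vs)))"
proof -
  have "distinct (SOME vs. distinct vs \<and> set vs = pverts G) \<and>
      set (SOME vs. distinct vs \<and> set vs = pverts G) = pverts G"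
    by (rule someI) (use assms in blast)
  then show ?thesis
    unfolding laplacian_spectrum_def using assms
    by (metis char_poly_laplacian_mat_enum)
qed

lemma pair_graph_token_graph:
  assumes "pair_graph G"
  shows "pair_graph (token_graph k G)"
proof -
  interpret pair_graph G by fact
  let ?V = "{S. S \<subseteq> pverts G \<and> card S = k}"
  have fin: "finite ?V" by simp
  have sub: "parcs (token_graph k G) \<subseteq> ?V \<times> ?V"
    by (auto simp: token_graph_def)
  show ?thesis
  proof
    show "finite (parcs (token_graph k G))"
      by (rule finite_subset[OF sub]) (use fin in simp)
    show "finite (pverts (token_graph k G))"
      using fin by (simp add: token_graph_def)
    show "symmetric (with_proj (token_graph k G))"
    proof -
      have "(T, S) \<in> parcs (token_graph k G)" if "(S, T) \<in> parcs (token_graph k G)" for S T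
        using that Un_commute[of "S - T" "T - S"] by (simp add: token_graph_def)
      then show ?thesis by (auto simp: symmetric_def sym_def)
    qed
    fix e assume e: "e \<in> parcs (token_graph k G)"
    then show "fst e \<in> pverts (token_graph k G)" "snd e \<in> pverts (token_graph k G)"
      by (auto simp: token_graph_def)
    show "fst e \<noteq> snd e"
    proof
      assume "fst e = snd e"
      moreover from e obtain S T a b where "e = (S, T)" "(S - T) \<union> (T - S) = {a, b}"
        unfolding token_graph_def by (cases e) (simp, blast)
      ultimately have "{a, b} = {}" by simp
      then show False by simp
    qed
  qed
qed

end

theory Submission
  imports Defs
begin

text \<open>
  Upper bound: a function \<open>x\<close> that vanishes on the clique \<open>K\<close>, is constant on \<open>G\<^sub>1\<close> and on
  \<open>G\<^sub>2 \<union> \<dots> \<union> G\<^sub>s\<close>, and sums to zero is a Laplacian eigenvector with eigenvalue \<open>r\<close>; so is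
  \<open>S \<mapsto> \<Sum>v\<in>S. x v\<close> on the \<open>k\<close>-subsets, because the terms inside \<open>S\<close> cancel.

  Lower bound: add the vertices of \<open>K\<close> one at a time. If \<open>v\<close> is adjacent to all of \<open>W\<close>, \<open>|W| = m\<close>, the
  Laplacian of the token graph on \<open>insert v W\<close> is that of the tokens moving in \<open>W\<close> plus that of the star at
  \<open>v\<close>. Functions depending only on the occupation of \<open>v\<close> contribute the star eigenvalue \<open>m + 1\<close>. On
  the orthogonal complement the star is bounded below by \<open>1\<close>, which amounts to the spectral gap \<open>m\<close> of the
  Johnson graphs on \<open>W\<close>. So each universal vertex raises the gap by \<open>1\<close>; applied to complete graphs, the
  same step yields the Johnson gap by induction.
\<close>

section \<open>The spectral gap of token graphs\<close>

text \<open>All token numbers are treated at once: a function on \<^term>\<open>Pow V\<close> is a family of functions on the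
  \<open>k\<close>-subsets, and every token move preserves the cardinality. Each edge of a token graph contributes
  twice, once per orientation; hence the factor \<open>2\<close> in \<open>token_gap\<close>.\<close>

definition token_energy :: "'a set \<Rightarrow> ('a \<times> 'a) set \<Rightarrow> ('a set \<Rightarrow> real) \<Rightarrow> real" where
  "token_energy V E f = (\<Sum>S\<in>Pow V. \<Sum>a\<in>S. \<Sum>b\<in>V - S.
     if (a, b) \<in> E then (f S - f (insert b (S - {a})))\<^sup>2 else 0)"

definition level_balanced :: "'a set \<Rightarrow> ('a set \<Rightarrow> real) \<Rightarrow> bool" where
  "level_balanced V f \<longleftrightarrow> (\<forall>k. (\<Sum>S\<in>{S\<in>Pow V. card S = k}. f S) = 0)"

definition token_gap :: "'a set \<Rightarrow> ('a \<times> 'a) set \<Rightarrow> real \<Rightarrow> bool" where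
  "token_gap V E c \<longleftrightarrow>
     (\<forall>f. level_balanced V f \<longrightarrow> 2 * c * (\<Sum>S\<in>Pow V. (f S)\<^sup>2) \<le> token_energy V E f)"

section \<open>Covering pairs of the subset lattice and level-balanced functions\<close>

text \<open>Both sides run over the pairs of a set and the same set with one more element
  \<open>a\<close>, indexed by the lower set on the left and by the upper set on the right.\<close>

lemma sum_subset_outside_eq_sum_subset_inside:
  fixes F :: "'a set \<Rightarrow> 'a \<Rightarrow> 'b::comm_monoid_add"
  assumes "finite W"
  shows "(\<Sum>S\<in>Pow W. \<Sum>a\<in>W - S. F S a) = (\<Sum>T\<in>Pow W. \<Sum>a\<in>T. F (T - {a}) a)"
proof -
  have fin: "finite S" if "S \<in> Pow W" for S
    using that assms by (auto intro: finite_subset)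
  have "(\<Sum>S\<in>Pow W. \<Sum>a\<in>W - S. F S a) = (\<Sum>(S, a)\<in>(SIGMA S:Pow W. W - S). F S a)"
    using assms by (subst sum.Sigma) auto
  also have "\<dots> = (\<Sum>(T, a)\<in>(SIGMA T:Pow W. T). F (T - {a}) a)"
    by (rule sum.reindex_bij_witness[of _ "\<lambda>(T, a). (T - {a}, a)" "\<lambda>(S, a). (insert a S, a)"]) auto
  also have "\<dots> = (\<Sum>T\<in>Pow W. \<Sum>a\<in>T. F (T - {a}) a)"
    using assms fin by (subst sum.Sigma) auto
  finally show ?thesis .
qed

text \<open>On each level \<open>\<phi> (card S)\<close> is constant and factors out. This is the
  orthogonality that removes the cross terms in \<open>square_sum_shift_levels\<close> and
  \<open>star_energy_shift_levels\<close>.\<close>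

lemma sum_level_balanced:
  assumes "finite W" "level_balanced W f"
  shows "(\<Sum>S\<in>Pow W. \<phi> (card S) * f S) = 0"
proof -
  have "(\<Sum>S\<in>Pow W. \<phi> (card S) * f S) =
      (\<Sum>k\<in>card ` Pow W. \<Sum>S\<in>{S\<in>Pow W. card S = k}. \<phi> (card S) * f S)"
    using assms by (intro sum.image_gen) auto
  also have "\<dots> = (\<Sum>k\<in>card ` Pow W. \<phi> k * (\<Sum>S\<in>{S\<in>Pow W. card S = k}. f S))"
    by (simp add: sum_distrib_left)
  also have "\<dots> = 0"
    using assms by (simp add: level_balanced_def)
  finally show ?thesis .
qed

lemma level_balanced_scale:
  assumes "level_balanced W f"
  shows "level_balanced W (\<lambda>S. \<phi> (card S) * f S)"
proof -
  have "(\<Sum>S\<in>{S\<in>Pow W. card S = k}. \<phi> (card S) * f S) =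
      \<phi> k * (\<Sum>S\<in>{S\<in>Pow W. card S = k}. f S)" for k
    by (simp add: sum_distrib_left)
  then show ?thesis using assms by (simp add: level_balanced_def)
qed

lemma level_balanced_empty:
  assumes "finite W" "level_balanced W f"
  shows "f {} = 0"
proof -
  have "{S\<in>Pow W. card S = 0} = {{}}"
    using assms(1) by (auto simp: card_eq_0_iff dest: finite_subset)
  then show ?thesis
    using assms(2) unfolding level_balanced_def by (auto dest: spec[of _ 0])
qed

lemma level_balanced_full:
  assumes "finite W" "level_balanced W f"
  shows "f W = 0"
proof -
  have "{S\<in>Pow W. card S = card W} = {W}"
    using assms(1) by (auto dest: card_subset_eq)
  then show ?thesis
    using assms(2) unfolding level_balanced_def by (auto dest: spec[of _ "card W"])
qed

section \<open>Johnson graphs and the lower bound for the star\<close>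

text \<open>Lagrange's identity. Applied to the values \<open>h (T - {a})\<close>, it trades the
  square of their sum for pairwise differences, which are a Johnson energy.\<close>

lemma square_sum_eq_pairwise:
  fixes x :: "'a \<Rightarrow> real"
  shows "(\<Sum>a\<in>A. x a)\<^sup>2 =
    real (card A) * (\<Sum>a\<in>A. (x a)\<^sup>2) - (\<Sum>a\<in>A. \<Sum>b\<in>A. (x a - x b)\<^sup>2) / 2"
proof -
  have "(\<Sum>a\<in>A. \<Sum>b\<in>A. (x a - x b)\<^sup>2) =
      2 * (real (card A) * (\<Sum>a\<in>A. (x a)\<^sup>2)) - 2 * (\<Sum>a\<in>A. x a)\<^sup>2"
  proof -
    have "(\<Sum>a\<in>A. \<Sum>b\<in>A. 2 * x a * x b) = 2 * (\<Sum>a\<in>A. x a)\<^sup>2"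
      unfolding power2_eq_square sum_product by (simp add: sum_distrib_left mult.assoc)
    then show ?thesis
      by (simp add: power2_diff sum.distrib sum_subtractf sum_distrib_left[symmetric])
  qed
  then show ?thesis by (simp add: diff_divide_distrib)
qed

text \<open>Moving a token from \<open>a\<close> to \<open>b\<close> inside
  \<open>T = insert b S\<close> leads from \<open>T - {b}\<close> to \<open>T - {a}\<close>. Two
  sets are thus adjacent in a Johnson graph iff they arise from a common \<open>T\<close> by
  deleting two different elements; the added diagonal terms \<open>a = b\<close> vanish.\<close>

lemma token_energy_complete:
  assumes "finite W"
  shows "token_energy W UNIV h =
    (\<Sum>T\<in>Pow W. \<Sum>a\<in>T. \<Sum>b\<in>T. (h (T - {a}) - h (T - {b}))\<^sup>2)"
proof -
  have "token_energy W UNIV h =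
      (\<Sum>S\<in>Pow W. \<Sum>b\<in>W - S. \<Sum>a\<in>S. (h S - h (insert b (S - {a})))\<^sup>2)"
    unfolding token_energy_def by (rule sum.cong) (simp_all, rule sum.swap)
  also have "\<dots> = (\<Sum>T\<in>Pow W. \<Sum>b\<in>T. \<Sum>a\<in>T - {b}.
      (h (T - {b}) - h (insert b (T - {b} - {a})))\<^sup>2)"
    by (rule sum_subset_outside_eq_sum_subset_inside[OF assms])
  also have "\<dots> = (\<Sum>T\<in>Pow W. \<Sum>b\<in>T. \<Sum>a\<in>T. (h (T - {b}) - h (T - {a}))\<^sup>2)"
  proof (rule sum.cong[OF refl], rule sum.cong[OF refl])
    fix T b assume "T \<in> Pow W" and b: "b \<in> T"
    then have fin: "finite T" using assms by (auto intro: finite_subset)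
    have "(\<Sum>a\<in>T - {b}. (h (T - {b}) - h (insert b (T - {b} - {a})))\<^sup>2) =
        (\<Sum>a\<in>T - {b}. (h (T - {b}) - h (T - {a}))\<^sup>2)"
    proof (rule sum.cong[OF refl])
      fix a assume "a \<in> T - {b}"
      then have "insert b (T - {b} - {a}) = T - {a}" using b by auto
      then show "(h (T - {b}) - h (insert b (T - {b} - {a})))\<^sup>2 = (h (T - {b}) - h (T - {a}))\<^sup>2"
        by simp
    qed
    then show "(\<Sum>a\<in>T - {b}. (h (T - {b}) - h (insert b (T - {b} - {a})))\<^sup>2) =
        (\<Sum>a\<in>T. (h (T - {b}) - h (T - {a}))\<^sup>2)"
      using sum.remove[OF fin b, of "\<lambda>a. (h (T - {b}) - h (T - {a}))\<^sup>2"] by simp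
  qed
  finally show ?thesis .
qed

text \<open>A norm bound for the operator that sums \<open>h\<close> over the sets one element
  smaller. By Lagrange's identity the left side is a diagonal part minus half the Johnson energy.
  The diagonal part weighs \<open>S\<close> by \<open>(m - |S|) * (|S| + 1)\<close>, the gap
  subtracts at least \<open>m\<close>, and \<open>|S| * (m - |S| - 1)\<close> remains.\<close>

lemma sum_square_up_le:
  assumes fin: "finite W" and gap: "token_gap W UNIV (card W)" and bal: "level_balanced W h"
  shows "(\<Sum>T\<in>Pow W. (\<Sum>a\<in>T. h (T - {a}))\<^sup>2) \<le>
    (\<Sum>S\<in>Pow W. real (card S) * (real (card W) - real (card S) - 1) * (h S)\<^sup>2)"
proof -
  let ?m = "real (card W)"
  have card_diff: "real (card (W - S)) = ?m - real (card S)" if "S \<in> Pow W" for S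
    using that fin by (simp add: card_Diff_subset finite_subset card_mono of_nat_diff)
  have "(\<Sum>T\<in>Pow W. real (card T) * (\<Sum>a\<in>T. (h (T - {a}))\<^sup>2)) =
      (\<Sum>T\<in>Pow W. \<Sum>a\<in>T. (real (card (T - {a})) + 1) * (h (T - {a}))\<^sup>2)"
  proof (intro sum.cong refl)
    fix T assume "T \<in> Pow W"
    then have "finite T" using fin by (auto intro: finite_subset)
    then have "real (card (T - {a})) + 1 = real (card T)" if "a \<in> T" for a
      using that card_Suc_Diff1[of T a] by linarith
    then show "real (card T) * (\<Sum>a\<in>T. (h (T - {a}))\<^sup>2) =
        (\<Sum>a\<in>T. (real (card (T - {a})) + 1) * (h (T - {a}))\<^sup>2)"
      by (simp add: sum_distrib_left)
  qed
  also have "\<dots> = (\<Sum>S\<in>Pow W. \<Sum>a\<in>W - S. (real (card S) + 1) * (h S)\<^sup>2)"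
    by (rule sum_subset_outside_eq_sum_subset_inside[OF fin, symmetric])
  also have "\<dots> = (\<Sum>S\<in>Pow W. (?m - real (card S)) * (real (card S) + 1) * (h S)\<^sup>2)"
    by (intro sum.cong refl) (simp add: card_diff)
  finally have 1: "(\<Sum>T\<in>Pow W. real (card T) * (\<Sum>a\<in>T. (h (T - {a}))\<^sup>2)) =
      (\<Sum>S\<in>Pow W. (?m - real (card S)) * (real (card S) + 1) * (h S)\<^sup>2)" .
  have 2: "2 * ?m * (\<Sum>S\<in>Pow W. (h S)\<^sup>2) \<le> token_energy W UNIV h"
    using gap bal by (simp add: token_gap_def)
  have "(\<Sum>T\<in>Pow W. (\<Sum>a\<in>T. h (T - {a}))\<^sup>2) =
      (\<Sum>T\<in>Pow W. real (card T) * (\<Sum>a\<in>T. (h (T - {a}))\<^sup>2)) - token_energy W UNIV h / 2"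
    by (simp add: square_sum_eq_pairwise token_energy_complete[OF fin] sum_subtractf
        sum_divide_distrib)
  also have "\<dots> \<le> (\<Sum>S\<in>Pow W. (?m - real (card S)) * (real (card S) + 1) * (h S)\<^sup>2) -
      ?m * (\<Sum>S\<in>Pow W. (h S)\<^sup>2)"
    using 1 2 by simp
  also have "\<dots> = (\<Sum>S\<in>Pow W. real (card S) * (?m - real (card S) - 1) * (h S)\<^sup>2)"
    by (simp add: sum_distrib_left sum_subtractf[symmetric] algebra_simps)
  finally show ?thesis .
qed

text \<open>Expanding the square gives the diagonal weights \<open>m - |S|\<close> for
  \<open>h\<close> and \<open>|T|\<close> for \<open>g\<close>, and a cross term. It is enough to
  bound the cross term by these weights lowered by \<open>1\<close>.\<close>

lemma star_energy_ge:
  assumes fin: "finite W" and gap: "token_gap W UNIV (card W)"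
    and bg: "level_balanced W g" and bh: "level_balanced W h"
  shows "(\<Sum>S\<in>Pow W. (g S)\<^sup>2) + (\<Sum>S\<in>Pow W. (h S)\<^sup>2) \<le>
    (\<Sum>S\<in>Pow W. \<Sum>a\<in>W - S. (h S - g (insert a S))\<^sup>2)"
proof -
  let ?m = "real (card W)"
  define u where "u T = (\<Sum>a\<in>T. h (T - {a}))" for T
  \<comment> \<open>The rescaling by \<open>1 / sqrt |S|\<close> balances the AM-GM step on all levels simultaneously; at \<open>S = {}\<close>
    it gives \<open>0\<close>, which is harmless because \<open>h {} = 0\<close>.\<close>
  define h' where "h' S = inverse (sqrt (real (card S))) * h S" for S
  have fin': "finite S" if "S \<in> Pow W" for S
    using that fin by (auto intro: finite_subset)
  have card_diff: "real (card (W - S)) = ?m - real (card S)" if "S \<in> Pow W" for S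
    using that fin by (simp add: card_Diff_subset finite_subset card_mono of_nat_diff)
  have g0: "g {} = 0" and h0: "h {} = 0"
    using level_balanced_empty fin bg bh by blast+
  have bh': "level_balanced W h'"
    unfolding h'_def by (rule level_balanced_scale[OF bh])
  have amgm: "2 * (g T * u T) \<le> (real (card T) - 1) * (g T)\<^sup>2 + (\<Sum>a\<in>T. h' (T - {a}))\<^sup>2"
    if "T \<in> Pow W" for T
  \<comment> \<open>For \<open>T = {}\<close> the coefficient \<open>card T - 1\<close> is negative,
    and for a singleton the divisor \<open>q\<close> used below would be \<open>0\<close>. Both
    cases are trivial because \<open>g\<close> and \<open>h\<close> vanish at the empty set.\<close>
  proof (cases "card T \<le> 1")
    case True
    moreover have "finite T" using that by (rule fin')
    ultimately consider "T = {}" | x where "T = {x}"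
      by (metis card_0_eq card_1_singletonE le_eq_less_or_eq less_one)
    then show ?thesis
      by cases (simp_all add: u_def g0 h0 h'_def)
  next
    case False
    define q where "q = sqrt (real (card T) - 1)"
    have q: "q > 0" "q\<^sup>2 = real (card T) - 1" using False by (auto simp: q_def)
    have "(\<Sum>a\<in>T. h' (T - {a})) = u T / q"
      unfolding u_def sum_divide_distrib h'_def q_def
      using fin'[OF that] False by (intro sum.cong refl) (simp add: of_nat_diff divide_inverse mult.commute)
    moreover have "2 * (g T * u T) = 2 * (q * g T) * (u T / q)" using q by simp
    moreover have "\<dots> \<le> (q * g T)\<^sup>2 + (u T / q)\<^sup>2"
      by (rule sum_squares_bound)
    ultimately show ?thesis by (simp add: power_mult_distrib q)
  qed
  have "2 * (\<Sum>T\<in>Pow W. g T * u T) \<le>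
      (\<Sum>T\<in>Pow W. (real (card T) - 1) * (g T)\<^sup>2) + (\<Sum>T\<in>Pow W. (\<Sum>a\<in>T. h' (T - {a}))\<^sup>2)"
    unfolding sum_distrib_left sum.distrib[symmetric] by (rule sum_mono) (rule amgm)
  also have "(\<Sum>T\<in>Pow W. (\<Sum>a\<in>T. h' (T - {a}))\<^sup>2) \<le>
      (\<Sum>S\<in>Pow W. real (card S) * (?m - real (card S) - 1) * (h' S)\<^sup>2)"
    by (rule sum_square_up_le[OF fin gap bh'])
  also have "\<dots> = (\<Sum>S\<in>Pow W. (?m - real (card S) - 1) * (h S)\<^sup>2)"
  proof (intro sum.cong refl)
    fix S assume S: "S \<in> Pow W"
    show "real (card S) * (?m - real (card S) - 1) * (h' S)\<^sup>2 =
        (?m - real (card S) - 1) * (h S)\<^sup>2"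
    proof (cases "S = {}")
      case True then show ?thesis by (simp add: h0)
    next
      case False
      then have "card S > 0" using fin'[OF S] by (simp add: card_gt_0_iff)
      then show ?thesis by (simp add: h'_def power_mult_distrib power_inverse)
    qed
  qed
  finally have cross: "2 * (\<Sum>T\<in>Pow W. g T * u T) \<le>
      (\<Sum>T\<in>Pow W. (real (card T) - 1) * (g T)\<^sup>2) +
      (\<Sum>S\<in>Pow W. (?m - real (card S) - 1) * (h S)\<^sup>2)" by simp
  have "(\<Sum>S\<in>Pow W. \<Sum>a\<in>W - S. (h S - g (insert a S))\<^sup>2) =
      (\<Sum>S\<in>Pow W. \<Sum>a\<in>W - S. (h S)\<^sup>2) +
      (\<Sum>S\<in>Pow W. \<Sum>a\<in>W - S. (g (insert a S))\<^sup>2 - 2 * h S * g (insert a S))"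
    by (simp add: power2_diff sum.distrib sum_subtractf)
  also have "(\<Sum>S\<in>Pow W. \<Sum>a\<in>W - S. (h S)\<^sup>2) = (\<Sum>S\<in>Pow W. (?m - real (card S)) * (h S)\<^sup>2)"
    by (intro sum.cong refl) (simp add: card_diff)
  also have "(\<Sum>S\<in>Pow W. \<Sum>a\<in>W - S. (g (insert a S))\<^sup>2 - 2 * h S * g (insert a S)) =
      (\<Sum>T\<in>Pow W. \<Sum>a\<in>T. (g (insert a (T - {a})))\<^sup>2 - 2 * h (T - {a}) * g (insert a (T - {a})))"
    by (rule sum_subset_outside_eq_sum_subset_inside[OF fin])
  also have "\<dots> = (\<Sum>T\<in>Pow W. real (card T) * (g T)\<^sup>2 - 2 * (g T * u T))"
    by (intro sum.cong refl)
      (simp add: insert_absorb sum_subtractf u_def sum_distrib_left mult_ac)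
  finally show ?thesis using cross
    by (simp add: sum_subtractf sum.distrib sum_distrib_left algebra_simps)
qed

section \<open>Adding a universal vertex\<close>

lemma sum_Pow_insert:
  fixes F :: "'a set \<Rightarrow> 'b::comm_monoid_add"
  assumes "finite W" "v \<notin> W"
  shows "(\<Sum>S\<in>Pow (insert v W). F S) = (\<Sum>S\<in>Pow W. F S) + (\<Sum>S\<in>Pow W. F (insert v S))"
proof -
  have inj: "inj_on (insert v) (Pow W)"
  proof (rule inj_onI)
    fix S T assume "S \<in> Pow W" "T \<in> Pow W" "insert v S = insert v T"
    moreover from this have "v \<notin> S" "v \<notin> T" using assms(2) by auto
    ultimately show "S = T" by (metis insert_ident)
  qed
  have "(\<Sum>S\<in>Pow (insert v W). F S) = (\<Sum>S\<in>Pow W. F S) + (\<Sum>S\<in>insert v ` Pow W. F S)"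
    unfolding Pow_insert using assms by (intro sum.union_disjoint) auto
  then show ?thesis by (simp add: sum.reindex[OF inj])
qed

text \<open>Moves avoiding \<open>v\<close> keep it empty or keep it occupied, which gives the first
  two terms. All moves between \<open>v\<close> and \<open>W\<close> are allowed by
  \<open>univ\<close>; each is counted in both directions, hence the factor
  \<open>2\<close>.\<close>

lemma token_energy_insert:
  assumes fin: "finite W" and v: "v \<notin> W"
    and univ: "\<And>x. x \<in> W \<Longrightarrow> (v, x) \<in> E \<and> (x, v) \<in> E"
  shows "token_energy (insert v W) E f =
    token_energy W E f + token_energy W E (\<lambda>S. f (insert v S)) +
    2 * (\<Sum>S\<in>Pow W. \<Sum>a\<in>W - S. (f (insert v S) - f (insert a S))\<^sup>2)"
proof -
  define d where "d S a b = (if (a, b) \<in> E then (f S - f (insert b (S - {a})))\<^sup>2 else 0)" for S a b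
  have fin': "finite S" if "S \<in> Pow W" for S
    using that fin by (auto intro: finite_subset)
  have A: "(\<Sum>a\<in>S. \<Sum>b\<in>insert v W - S. d S a b) =
      (\<Sum>a\<in>S. \<Sum>b\<in>W - S. d S a b) + (\<Sum>a\<in>S. (f (insert v (S - {a})) - f S)\<^sup>2)"
    if S: "S \<in> Pow W" for S
  proof -
    have "insert v W - S = insert v (W - S)" using S v by auto
    then have "(\<Sum>a\<in>S. \<Sum>b\<in>insert v W - S. d S a b) = (\<Sum>a\<in>S. d S a v + (\<Sum>b\<in>W - S. d S a b))"
      using fin v by simp
    also have "\<dots> = (\<Sum>a\<in>S. (f (insert v (S - {a})) - f S)\<^sup>2 + (\<Sum>b\<in>W - S. d S a b))"
      using S univ by (intro sum.cong refl arg_cong2[of _ _ _ _ "(+)"])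
        (auto simp: d_def power2_commute)
    finally show ?thesis by (simp add: sum.distrib add.commute)
  qed
  have B: "(\<Sum>a\<in>insert v S. \<Sum>b\<in>insert v W - insert v S. d (insert v S) a b) =
      (\<Sum>a\<in>S. \<Sum>b\<in>W - S. if (a, b) \<in> E
        then (f (insert v S) - f (insert v (insert b (S - {a}))))\<^sup>2 else 0) +
      (\<Sum>b\<in>W - S. (f (insert v S) - f (insert b S))\<^sup>2)"
    if S: "S \<in> Pow W" for S
  proof -
    have vS: "v \<notin> S" using S v by auto
    have eq: "insert v W - insert v S = W - S" using S v by auto
    have 1: "d (insert v S) v b = (f (insert v S) - f (insert b S))\<^sup>2" if "b \<in> W - S" for b
      using that univ vS by (auto simp: d_def)
    have 2: "d (insert v S) a b = (if (a, b) \<in> E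
        then (f (insert v S) - f (insert v (insert b (S - {a}))))\<^sup>2 else 0)" if "a \<in> S" for a b
    proof -
      have "insert b (insert v S - {a}) = insert v (insert b (S - {a}))" using that vS by auto
      then show ?thesis by (simp add: d_def)
    qed
    show ?thesis unfolding eq using fin'[OF S] vS by (simp add: 1 2 add.commute)
  qed
  have "token_energy (insert v W) E f =
     (\<Sum>S\<in>Pow (insert v W). \<Sum>a\<in>S. \<Sum>b\<in>insert v W - S. d S a b)"
    by (simp add: token_energy_def d_def)
  also have "\<dots> = (\<Sum>S\<in>Pow W. \<Sum>a\<in>S. \<Sum>b\<in>insert v W - S. d S a b) +
      (\<Sum>S\<in>Pow W. \<Sum>a\<in>insert v S. \<Sum>b\<in>insert v W - insert v S. d (insert v S) a b)"
    by (rule sum_Pow_insert[OF fin v])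
  also have "(\<Sum>S\<in>Pow W. \<Sum>a\<in>S. \<Sum>b\<in>insert v W - S. d S a b) =
      token_energy W E f + (\<Sum>S\<in>Pow W. \<Sum>a\<in>S. (f (insert v (S - {a})) - f S)\<^sup>2)"
    unfolding token_energy_def d_def[symmetric] sum.distrib[symmetric]
    by (rule sum.cong[OF refl]) (simp add: A sum.distrib)
  also have "(\<Sum>S\<in>Pow W. \<Sum>a\<in>insert v S. \<Sum>b\<in>insert v W - insert v S. d (insert v S) a b) =
      token_energy W E (\<lambda>S. f (insert v S)) +
      (\<Sum>S\<in>Pow W. \<Sum>a\<in>W - S. (f (insert v S) - f (insert a S))\<^sup>2)"
    unfolding token_energy_def sum.distrib[symmetric] by (rule sum.cong[OF refl]) (rule B)
  \<comment> \<open>Moving a token from \<open>a\<close> onto \<open>v\<close> reverses the move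
    from \<open>v\<close> to \<open>a\<close>, so indexing by \<open>S - {a}\<close> turns this sum
    into the other star sum.\<close>
  also have "(\<Sum>S\<in>Pow W. \<Sum>a\<in>S. (f (insert v (S - {a})) - f S)\<^sup>2) =
      (\<Sum>T\<in>Pow W. \<Sum>a\<in>T. (f (insert v (T - {a})) - f (insert a (T - {a})))\<^sup>2)"
    by (intro sum.cong refl) (simp add: insert_absorb)
  also have "\<dots> = (\<Sum>S\<in>Pow W. \<Sum>a\<in>W - S. (f (insert v S) - f (insert a S))\<^sup>2)"
    by (rule sum_subset_outside_eq_sum_subset_inside[OF fin, symmetric])
  finally show ?thesis by simp
qed

text \<open>A token move preserves the cardinality, so the added function cancels in every
  difference.\<close>

lemma token_energy_shift_levels:
  assumes "finite W"
  shows "token_energy W E (\<lambda>S. \<phi> (card S) + f S) = token_energy W E f"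
  unfolding token_energy_def
proof (intro sum.cong refl)
  fix S a b assume "S \<in> Pow W" "a \<in> S" "b \<in> W - S"
  then have "card (insert b (S - {a})) = card S"
    using assms by (simp add: finite_subset card_Suc_Diff1 del: card_Diff_insert)
  then show "(if (a, b) \<in> E then (\<phi> (card S) + f S -
      (\<phi> (card (insert b (S - {a}))) + f (insert b (S - {a}))))\<^sup>2 else 0) =
      (if (a, b) \<in> E then (f S - f (insert b (S - {a})))\<^sup>2 else 0)" by simp
qed

lemma square_sum_shift_levels:
  assumes "finite W" "level_balanced W f"
  shows "(\<Sum>S\<in>Pow W. (\<phi> (card S) + f S)\<^sup>2) =
    (\<Sum>S\<in>Pow W. (\<phi> (card S))\<^sup>2) + (\<Sum>S\<in>Pow W. (f S)\<^sup>2)"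
  using sum_level_balanced[OF assms, of "\<lambda>k. 2 * \<phi> k"]
  by (simp add: power2_sum sum.distrib)

text \<open>In the cross term, the part with \<open>h\<close> and the part with \<open>g\<close> are
  each a level-balanced function against a function of the cardinality. For \<open>g\<close> this
  becomes visible after indexing by the larger set.\<close>

lemma star_energy_shift_levels:
  assumes fin: "finite W" and bg: "level_balanced W g" and bh: "level_balanced W h"
  shows "(\<Sum>S\<in>Pow W. \<Sum>a\<in>W - S. (\<phi> (card S) + (h S - g (insert a S)))\<^sup>2) =
    (\<Sum>S\<in>Pow W. \<Sum>a\<in>W - S. (\<phi> (card S))\<^sup>2) + (\<Sum>S\<in>Pow W. \<Sum>a\<in>W - S. (h S - g (insert a S))\<^sup>2)"
proof -
  have card_diff: "real (card (W - S)) = real (card W) - real (card S)" if "S \<in> Pow W" for S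
    using that fin by (simp add: card_Diff_subset finite_subset card_mono)
  have "(\<Sum>S\<in>Pow W. \<Sum>a\<in>W - S. 2 * \<phi> (card S) * h S) =
      (\<Sum>S\<in>Pow W. ((real (card W) - real (card S)) * (2 * \<phi> (card S))) * h S)"
    by (intro sum.cong refl) (simp add: card_diff)
  also have "\<dots> = 0"
    by (rule sum_level_balanced[OF fin bh, of "\<lambda>k. (real (card W) - real k) * (2 * \<phi> k)"])
  finally have 1: "(\<Sum>S\<in>Pow W. \<Sum>a\<in>W - S. 2 * \<phi> (card S) * h S) = 0" .
  have "(\<Sum>S\<in>Pow W. \<Sum>a\<in>W - S. 2 * \<phi> (card S) * g (insert a S)) =
      (\<Sum>T\<in>Pow W. \<Sum>a\<in>T. 2 * \<phi> (card (T - {a})) * g (insert a (T - {a})))"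
    by (rule sum_subset_outside_eq_sum_subset_inside[OF fin])
  also have "\<dots> = (\<Sum>T\<in>Pow W. (real (card T) * (2 * \<phi> (card T - 1))) * g T)"
    using fin by (intro sum.cong refl) (simp add: insert_absorb finite_subset)
  also have "\<dots> = 0"
    by (rule sum_level_balanced[OF fin bg, of "\<lambda>k. real k * (2 * \<phi> (k - 1))"])
  finally have 2: "(\<Sum>S\<in>Pow W. \<Sum>a\<in>W - S. 2 * \<phi> (card S) * g (insert a S)) = 0" .
  have "(\<phi> (card S) + (h S - g (insert a S)))\<^sup>2 = (\<phi> (card S))\<^sup>2 + (h S - g (insert a S))\<^sup>2 +
      2 * \<phi> (card S) * h S - 2 * \<phi> (card S) * g (insert a S)" for S a
    by (simp add: power2_eq_square algebra_simps)
  then show ?thesis using 1 2 by (simp add: sum.distrib sum_subtractf)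
qed

text \<open>The balanced remainders gain \<open>c\<close> from the moves inside \<open>W\<close> and
  \<open>1\<close> from the star, the latter by \<open>complete\<close>. The part that sees only the
  occupation of \<open>v\<close> gains nothing inside \<open>W\<close>, but \<open>m + 1\<close>
  from the star, which suffices because \<open>c\<close> is at most \<open>m\<close>.\<close>

lemma token_gap_insert:
  assumes fin: "finite W" and v: "v \<notin> W"
    and univ: "\<And>x. x \<in> W \<Longrightarrow> (v, x) \<in> E \<and> (x, v) \<in> E"
    and complete: "token_gap W UNIV (card W)"
    and gap: "token_gap W E c" and c: "c \<le> card W"
  shows "token_gap (insert v W) E (c + 1)"
  unfolding token_gap_def
proof (intro allI impI)
  fix f :: "'a set \<Rightarrow> real" assume bal: "level_balanced (insert v W) f"
  let ?m = "card W" and ?h = "\<lambda>S. f (insert v S)"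
  have fin': "finite S" if "S \<in> Pow W" for S
    using that fin by (auto intro: finite_subset)
  have card_diff: "real (card (W - S)) = real (card W) - real (card S)" if "S \<in> Pow W" for S
    using that fin by (simp add: card_Diff_subset finite_subset card_mono)
  define H where "H j = (\<Sum>S\<in>{S\<in>Pow W. card S = j}. ?h S)" for j
  \<comment> \<open>\<open>H j\<close> collects the sets of size \<open>j + 1\<close> containing
    \<open>v\<close>, so balance on that level forces the opposite sum on the sets avoiding
    \<open>v\<close>.\<close>
  have level: "(\<Sum>S\<in>{S\<in>Pow W. card S = Suc j}. f S) = - H j" for j
  proof -
    have "0 = (\<Sum>S\<in>Pow (insert v W). if card S = Suc j then f S else 0)"
      using bal fin sum.inter_filter[of "Pow (insert v W)" f "\<lambda>S. card S = Suc j"]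
      unfolding level_balanced_def by simp
    also have "\<dots> = (\<Sum>S\<in>Pow W. if card S = Suc j then f S else 0) +
        (\<Sum>S\<in>Pow W. if card (insert v S) = Suc j then ?h S else 0)"
      by (rule sum_Pow_insert[OF fin v])
    also have "(\<Sum>S\<in>Pow W. if card (insert v S) = Suc j then ?h S else 0) =
        (\<Sum>S\<in>Pow W. if card S = j then ?h S else 0)"
    proof (rule sum.cong[OF refl])
      fix S assume S: "S \<in> Pow W"
      then have "v \<notin> S" using v by auto
      then show "(if card (insert v S) = Suc j then ?h S else 0) = (if card S = j then ?h S else 0)"
        using fin'[OF S] by simp
    qed
    finally show ?thesis
      using fin sum.inter_filter[of "Pow W" f "\<lambda>S. card S = Suc j"]
        sum.inter_filter[of "Pow W" ?h "\<lambda>S. card S = j"]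
      by (simp add: H_def)
  qed
  \<comment> \<open>The part of \<open>f\<close> that on each level depends only on whether \<open>v\<close> is occupied is a multiple of
    \<open>S \<mapsto> (m + 1) [v \<in> S] - |S|\<close>, an eigenvector of the star at \<open>v\<close> with eigenvalue \<open>m + 1\<close>; \<open>t\<close> is
    that multiple, and the remainders \<open>g1\<close>, \<open>h1\<close> are level-balanced on \<open>W\<close>.\<close>
  define t where "t j = H j / (real (?m choose j) * (real ?m - real j))" for j
  define h1 where "h1 S = ?h S - (real ?m - real (card S)) * t (card S)" for S
  \<comment> \<open>A set avoiding \<open>v\<close> lies on the same level as
    \<open>insert v S'\<close> with \<open>S'\<close> one element smaller, hence the index
    \<open>card S - 1\<close>. At \<open>S = {}\<close> the truncated subtraction is harmless, since
    its factor is \<open>0\<close>.\<close>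
  define g1 where "g1 S = f S + real (card S) * t (card S - 1)" for S
  have level_card: "card {S\<in>Pow W. card S = j} = ?m choose j" for j
    using n_subsets[OF fin, of j] by simp
  \<comment> \<open>The division defining \<open>t\<close> is by \<open>0\<close> from
    \<open>j = m\<close> on, so \<open>H j = 0\<close> is needed there: at \<open>j = m\<close>
    because a balanced \<open>f\<close> vanishes on the full set, beyond because there are no such
    sets.\<close>
  have H_t: "H j = real (?m choose j) * ((real ?m - real j) * t j)" for j
  proof -
    consider "j < ?m" | "j = ?m" | "j > ?m" by linarith
    then show ?thesis
    proof cases
      case 1 then show ?thesis by (simp add: t_def)
    next
      case 2
      have "{S\<in>Pow W. card S = ?m} = {W}" using fin by (auto dest: card_subset_eq)
      moreover have "f (insert v W) = 0"
        using level_balanced_full[OF _ bal] fin by simp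
      ultimately show ?thesis using 2 by (simp add: H_def)
    next
      case 3
      have no: "card S \<noteq> j" if "S \<in> Pow W" for S
        using card_mono[OF fin, of S] that 3 by auto
      have "{S\<in>Pow W. card S = j} = {}" using no by auto
      then have "H j = 0" unfolding H_def by (simp only: sum.empty)
      then show ?thesis using 3 by simp
    qed
  qed
  have bh: "level_balanced W h1"
    unfolding level_balanced_def
  proof
    fix k
    have "(\<Sum>S\<in>{S\<in>Pow W. card S = k}. h1 S) =
        (\<Sum>S\<in>{S\<in>Pow W. card S = k}. ?h S - (real ?m - real k) * t k)"
      by (rule sum.cong) (auto simp: h1_def)
    also have "\<dots> = H k - real (?m choose k) * ((real ?m - real k) * t k)"
      unfolding sum_subtractf sum_constant level_card H_def by simp
    finally show "(\<Sum>S\<in>{S\<in>Pow W. card S = k}. h1 S) = 0" by (simp add: H_t)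
  qed
  have bg: "level_balanced W g1"
    unfolding level_balanced_def
  proof
    fix k
    have "(\<Sum>S\<in>{S\<in>Pow W. card S = k}. g1 S) =
        (\<Sum>S\<in>{S\<in>Pow W. card S = k}. f S + real k * t (k - 1))"
      by (rule sum.cong) (auto simp: g1_def)
    also have "\<dots> = (\<Sum>S\<in>{S\<in>Pow W. card S = k}. f S) + real (?m choose k) * (real k * t (k - 1))"
      unfolding sum.distrib sum_constant level_card by simp
    also have "\<dots> = 0"
    proof (cases k)
      case 0
      have "{S\<in>Pow W. card S = 0} = {{}}" using fin' by (auto simp: card_eq_0_iff)
      moreover have "f {} = 0" using level_balanced_empty[OF _ bal] fin by simp
      ultimately show ?thesis using 0 by simp
    next
      case (Suc j)
      \<comment> \<open>This identity is why a single multiplier \<open>t j\<close> balances both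
        the sets with \<open>v\<close> and those without it.\<close>
      have "real (?m choose Suc j) * real (Suc j) =
          real (?m choose j) * (real ?m - real j)"
      proof (cases "j \<le> ?m")
        case True
        have "Suc j * (?m choose Suc j) = (?m - j) * (?m choose j)"
          by (metis Suc_times_binomial_eq binomial_absorb_comp mult.commute binomial_absorption True)
        then have "real (Suc j * (?m choose Suc j)) = real ((?m - j) * (?m choose j))" by simp
        then show ?thesis using True by (simp only: of_nat_mult of_nat_diff mult.commute)
      qed (simp add: binomial_eq_0)
      then show ?thesis unfolding Suc level H_t 
        by (simp only: diff_Suc_1 mult.assoc[symmetric])
    qed
    finally show "(\<Sum>S\<in>{S\<in>Pow W. card S = k}. g1 S) = 0" .
  qed
  \<comment> \<open>The part depending on \<open>v\<close> has squared norm
    \<open>(m + 1) * X\<close> and star energy \<open>(m + 1)^2 * X\<close>, with each star edge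
    counted once.\<close>
  define X where "X = (\<Sum>S\<in>Pow W. \<Sum>a\<in>W - S. (t (card S))\<^sup>2)"
  have f_eq: "f = (\<lambda>S. - (real (card S) * t (card S - 1)) + g1 S)"
    by (simp add: g1_def fun_eq_iff)
  have h_eq: "?h = (\<lambda>S. (real ?m - real (card S)) * t (card S) + h1 S)"
    by (simp add: h1_def fun_eq_iff)
  have Ef: "token_energy W E f = token_energy W E g1"
    by (subst f_eq) (rule token_energy_shift_levels[OF fin, of _ "\<lambda>k. - (real k * t (k - 1))"])
  have Eh: "token_energy W E ?h = token_energy W E h1"
    by (subst h_eq) (rule token_energy_shift_levels[OF fin, of _ "\<lambda>k. (real ?m - real k) * t k"])
  have star: "(\<Sum>S\<in>Pow W. \<Sum>a\<in>W - S. (?h S - f (insert a S))\<^sup>2) =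
      (real ?m + 1)\<^sup>2 * X + (\<Sum>S\<in>Pow W. \<Sum>a\<in>W - S. (h1 S - g1 (insert a S))\<^sup>2)"
  proof -
    \<comment> \<open>Across a star edge the coefficients \<open>m - |S|\<close> and
      \<open>|S| + 1\<close> of \<open>t (card S)\<close> add up to \<open>m + 1\<close>.\<close>
    have "(\<Sum>S\<in>Pow W. \<Sum>a\<in>W - S. (?h S - f (insert a S))\<^sup>2) =
        (\<Sum>S\<in>Pow W. \<Sum>a\<in>W - S. ((real ?m + 1) * t (card S) + (h1 S - g1 (insert a S)))\<^sup>2)"
      using fin' by (intro sum.cong refl arg_cong[of _ _ "\<lambda>x. x\<^sup>2"])
        (simp add: h1_def g1_def algebra_simps)
    also have "\<dots> = (\<Sum>S\<in>Pow W. \<Sum>a\<in>W - S. ((real ?m + 1) * t (card S))\<^sup>2) +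
        (\<Sum>S\<in>Pow W. \<Sum>a\<in>W - S. (h1 S - g1 (insert a S))\<^sup>2)"
      by (rule star_energy_shift_levels[OF fin bg bh])
    finally show ?thesis by (simp add: X_def power_mult_distrib sum_distrib_left mult_ac)
  qed
  have norm: "(\<Sum>S\<in>Pow (insert v W). (f S)\<^sup>2) =
      (real ?m + 1) * X + (\<Sum>S\<in>Pow W. (g1 S)\<^sup>2) + (\<Sum>S\<in>Pow W. (h1 S)\<^sup>2)"
  proof -
    have 1: "(\<Sum>S\<in>Pow W. (f S)\<^sup>2) =
        (\<Sum>S\<in>Pow W. (- (real (card S) * t (card S - 1)))\<^sup>2) + (\<Sum>S\<in>Pow W. (g1 S)\<^sup>2)"
      by (subst f_eq) (rule square_sum_shift_levels[OF fin bg, of "\<lambda>k. - (real k * t (k - 1))"])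
    have 2: "(\<Sum>S\<in>Pow W. (?h S)\<^sup>2) =
        (\<Sum>S\<in>Pow W. ((real ?m - real (card S)) * t (card S))\<^sup>2) + (\<Sum>S\<in>Pow W. (h1 S)\<^sup>2)"
      using square_sum_shift_levels[OF fin bh, of "\<lambda>k. (real ?m - real k) * t k"]
      by (simp add: h1_def)
    \<comment> \<open>One of the two factors \<open>card T\<close> in the square is spread out as a
      sum over \<open>a \<in> T\<close>, so that the sum can be indexed by
      \<open>T - {a}\<close>.\<close>
    have "(\<Sum>S\<in>Pow W. (- (real (card S) * t (card S - 1)))\<^sup>2) =
        (\<Sum>T\<in>Pow W. \<Sum>a\<in>T. (real (card (T - {a})) + 1) * (t (card (T - {a})))\<^sup>2)"
    proof (intro sum.cong refl)
      fix T assume T: "T \<in> Pow W"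
      have eq: "(\<Sum>a\<in>T. (real (card (T - {a})) + 1) * (t (card (T - {a})))\<^sup>2) =
          (\<Sum>a\<in>T. real (card T) * (t (card T - 1))\<^sup>2)"
      proof (intro sum.cong refl)
        fix a assume "a \<in> T"
        then have "card T = Suc (card (T - {a}))"
          using fin'[OF T] by (simp add: card_Suc_Diff1 del: card_Diff_insert)
        then show "(real (card (T - {a})) + 1) * (t (card (T - {a})))\<^sup>2 =
            real (card T) * (t (card T - 1))\<^sup>2" by simp
      qed
      show "(- (real (card T) * t (card T - 1)))\<^sup>2 =
          (\<Sum>a\<in>T. (real (card (T - {a})) + 1) * (t (card (T - {a})))\<^sup>2)"
        unfolding eq by (simp add: power2_eq_square)
    qed
    also have "\<dots> = (\<Sum>S\<in>Pow W. \<Sum>a\<in>W - S. (real (card S) + 1) * (t (card S))\<^sup>2)"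
      by (rule sum_subset_outside_eq_sum_subset_inside[OF fin, symmetric])
    finally have 3: "(\<Sum>S\<in>Pow W. (- (real (card S) * t (card S - 1)))\<^sup>2) =
        (\<Sum>S\<in>Pow W. \<Sum>a\<in>W - S. (real (card S) + 1) * (t (card S))\<^sup>2)" .
    have 4: "(\<Sum>S\<in>Pow W. ((real ?m - real (card S)) * t (card S))\<^sup>2) =
        (\<Sum>S\<in>Pow W. \<Sum>a\<in>W - S. (real ?m - real (card S)) * (t (card S))\<^sup>2)"
      by (intro sum.cong refl) (simp add: card_diff power2_eq_square)
    have 5: "(\<Sum>S\<in>Pow W. \<Sum>a\<in>W - S. (real (card S) + 1) * (t (card S))\<^sup>2) +
        (\<Sum>S\<in>Pow W. \<Sum>a\<in>W - S. (real ?m - real (card S)) * (t (card S))\<^sup>2) = (real ?m + 1) * X"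
      unfolding X_def sum_distrib_left sum.distrib[symmetric]
      by (intro sum.cong refl) (simp add: algebra_simps)
    show ?thesis
      unfolding sum_Pow_insert[OF fin v] using 1 2 3 4 5 by linarith
  qed
  define Z0 Z1 Ng Nh Y where "Z0 = (c + 1) * ((real ?m + 1) * X)" and "Z1 = (real ?m + 1)\<^sup>2 * X"
    and "Ng = (\<Sum>S\<in>Pow W. (g1 S)\<^sup>2)" and "Nh = (\<Sum>S\<in>Pow W. (h1 S)\<^sup>2)"
    and "Y = (\<Sum>S\<in>Pow W. \<Sum>a\<in>W - S. (h1 S - g1 (insert a S))\<^sup>2)"
  have "X \<ge> 0" by (auto simp: X_def intro!: sum_nonneg)
  then have "(c + 1) * ((real ?m + 1) * X) \<le> (real ?m + 1) * ((real ?m + 1) * X)"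
    using c by (intro mult_right_mono mult_nonneg_nonneg) auto
  then have "Z0 \<le> Z1"
    by (simp only: Z0_def Z1_def power2_eq_square mult.assoc)
  have gaps: "2 * c * Ng \<le> token_energy W E g1" "2 * c * Nh \<le> token_energy W E h1"
    using gap bg bh by (auto simp: token_gap_def Ng_def Nh_def)
  have "Ng + Nh \<le> Y"
    unfolding Ng_def Nh_def Y_def by (rule star_energy_ge[OF fin complete bg bh])
  have "2 * (c + 1) * (\<Sum>S\<in>Pow (insert v W). (f S)\<^sup>2) =
      2 * Z0 + 2 * c * Ng + 2 * c * Nh + 2 * Ng + 2 * Nh"
    unfolding Z0_def norm Ng_def[symmetric] Nh_def[symmetric] by (simp add: algebra_simps)
  also have "\<dots> \<le> token_energy W E g1 + token_energy W E h1 + 2 * (Z1 + Y)"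
    using gaps \<open>Z0 \<le> Z1\<close> \<open>Ng + Nh \<le> Y\<close> by argo
  also have "\<dots> = token_energy (insert v W) E f"
    unfolding Z1_def Ef[symmetric] Eh[symmetric] Y_def star[symmetric]
    by (rule token_energy_insert[OF fin v, symmetric]) (rule univ)
  finally show "2 * (c + 1) * (\<Sum>S\<in>Pow (insert v W). (f S)\<^sup>2) \<le> token_energy (insert v W) E f" .
qed

text \<open>For \<open>E = UNIV\<close> and \<open>c = card W\<close>, the induction hypothesis
  supplies both gap assumptions of \<open>token_gap_insert\<close>. The loops in \<open>UNIV\<close>
  do not matter, as moves only go from \<open>S\<close> to its complement.\<close>

lemma token_gap_complete:
  assumes "finite V"
  shows "token_gap V UNIV (card V)"
  using assms
proof (induction V)
  case empty
  show ?case by (simp add: token_gap_def token_energy_def)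
next
  case (insert v W)
  then have "token_gap (insert v W) UNIV (real (card W) + 1)"
    by (intro token_gap_insert) auto
  then show ?case using insert by (simp add: add.commute)
qed

text \<open>Induction on \<open>K\<close>, deleting a universal vertex from \<open>K\<close> and
  from \<open>V\<close> at once. With no such vertex left, the gap \<open>0\<close> is nonnegativity
  of the energy.\<close>

lemma token_gap_universal_vertices:
  assumes "finite V" "K \<subseteq> V"
    and "\<And>u x. u \<in> K \<Longrightarrow> x \<in> V \<Longrightarrow> u \<noteq> x \<Longrightarrow> (u, x) \<in> E \<and> (x, u) \<in> E"
  shows "token_gap V E (card K)"
proof -
  have "finite K" using assms finite_subset by blast
  then show ?thesis using assms
  proof (induction K arbitrary: V)
    case empty
    show ?case by (auto simp: token_gap_def token_energy_def intro!: sum_nonneg)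
  next
    case (insert v K)
    let ?W = "V - {v}"
    have "token_gap (insert v ?W) E (real (card K) + 1)"
    proof (rule token_gap_insert)
      show "token_gap ?W E (real (card K))"
        using insert by (intro insert.IH) auto
      show "token_gap ?W UNIV (real (card ?W))"
        using insert by (intro token_gap_complete) auto
      have "card K \<le> card ?W"
        using insert by (intro card_mono) auto
      then show "real (card K) \<le> real (card ?W)" by simp
    qed (use insert in auto)
    then show ?case using insert by (simp add: add.commute insert_absorb)
  qed
qed

section \<open>Algebraic connectivity from a gap and an eigenvector\<close>

text \<open>In a basis that starts with the all-ones vector, which \<open>A\<close> kills, the
  matrix is block triangular with a \<open>1 \<times> 1\<close> zero block; the other block is the
  action modulo constants.\<close>

lemma char_poly_zero_row_sums:
  fixes A :: "'a::field mat"
  assumes A: "A \<in> carrier_mat (Suc m) (Suc m)"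
    and rows: "\<And>i. i < Suc m \<Longrightarrow> (\<Sum>j<Suc m. A $$ (i, j)) = 0"
  shows "char_poly A =
    [:0, 1:] * char_poly (mat m m (\<lambda>(i, j). A $$ (Suc i, Suc j) - A $$ (0, Suc j)))"
proof -
  define M where "M = mat m m (\<lambda>(i, j). A $$ (Suc i, Suc j) - A $$ (0, Suc j))"
  define R where "R = mat 1 m (\<lambda>(i, j). A $$ (0, Suc j))"
  define B where "B = four_block_mat (0\<^sub>m 1 1) R (0\<^sub>m m 1) M"
  \<comment> \<open>\<open>P 1\<close> is the change of basis and \<open>P (- 1)\<close> its
    inverse: left multiplication by \<open>P e\<close> adds \<open>e\<close> times row
    \<open>0\<close> to every other row.\<close>
  define P :: "'a \<Rightarrow> 'a mat"
    where "P e = mat (Suc m) (Suc m) (\<lambda>(i, j). if i = j then 1 else if j = 0 then e else 0)" for e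
  have "B \<in> carrier_mat (1 + m) (1 + m)"
    unfolding B_def by (rule four_block_carrier_mat) (simp_all add: M_def)
  then have c: "B \<in> carrier_mat (Suc m) (Suc m)" "P e \<in> carrier_mat (Suc m) (Suc m)" for e
    by (simp_all add: P_def)
  have B0: "B $$ (i, 0) = 0" if "i < Suc m" for i
    using that by (auto simp: B_def R_def M_def)
  have BR: "B $$ (0, Suc j) = A $$ (0, Suc j)" if "j < m" for j
    using that by (auto simp: B_def R_def M_def)
  have BM: "B $$ (Suc i, Suc j) = A $$ (Suc i, Suc j) - A $$ (0, Suc j)" if "i < m" "j < m" for i j
    using that by (auto simp: B_def R_def M_def)
  have mult_left: "(P e * D) $$ (i, j) = D $$ (i, j) + (if i = 0 then 0 else e * D $$ (0, j))"
    if "D \<in> carrier_mat (Suc m) (Suc m)" "i < Suc m" "j < Suc m" for D i j e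
  proof -
    have "(P e * D) $$ (i, j) = (\<Sum>l = 0..<Suc m. P e $$ (i, l) * D $$ (l, j))"
      using that c by (auto simp: scalar_prod_def P_def)
    also have "\<dots> = (\<Sum>l = 0..<Suc m. (if l = i then D $$ (l, j) else 0) +
        (if l = 0 then (if i = 0 then 0 else e * D $$ (0, j)) else 0))"
      using that by (intro sum.cong refl) (auto simp: P_def)
    also have "\<dots> = D $$ (i, j) + (if i = 0 then 0 else e * D $$ (0, j))"
      using that by (simp add: sum.distrib del: sum.op_ivl_Suc)
    finally show ?thesis .
  qed
  have inverse: "P e * P (- e) = 1\<^sub>m (Suc m)" for e
    by (rule eq_matI) (use c in \<open>auto simp: mult_left simp del: index_mult_mat(1)\<close>, auto simp: P_def)
  have "A * P 1 = P 1 * B"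
  proof (rule eq_matI)
    fix i j assume "i < dim_row (P 1 * B)" "j < dim_col (P 1 * B)"
    then have ij: "i < Suc m" "j < Suc m" using c(1) c(2)[of 1] by auto
    have "(A * P 1) $$ (i, j) = (\<Sum>l = 0..<Suc m. A $$ (i, l) * P 1 $$ (l, j))"
      using ij A by (auto simp: scalar_prod_def P_def)
    also have "\<dots> = (\<Sum>l = 0..<Suc m. if j = 0 \<or> l = j then A $$ (i, l) else 0)"
      using ij by (intro sum.cong refl) (auto simp: P_def)
    also have "\<dots> = (if j = 0 then 0 else A $$ (i, j))"
      using ij rows[of i] by (simp add: atLeast0LessThan del: sum.op_ivl_Suc sum.lessThan_Suc)
    also have "\<dots> = (P 1 * B) $$ (i, j)"
      unfolding mult_left[OF c(1) ij] using ij
      by (cases i; cases j) (simp_all add: B0 BR BM)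
    finally show "(A * P 1) $$ (i, j) = (P 1 * B) $$ (i, j)" .
  qed (use A c(1) c(2)[of 1] in auto)
  then have "A * (P 1 * P (- 1)) = P 1 * B * P (- 1)"
    using A c by (metis assoc_mult_mat)
  then have "A = P 1 * B * P (- 1)"
    using A by (simp add: inverse)
  then have "similar_mat A B"
    using A c inverse[of 1] inverse[of "- 1"]
    by (intro similar_matI[of _ _ "P 1" "P (- 1)" "Suc m"]) auto
  then have "char_poly A = char_poly B" by (rule char_poly_similar)
  also have "\<dots> = char_poly (0\<^sub>m 1 1 :: 'a mat) * char_poly M"
    unfolding B_def by (rule char_poly_four_block_zeros_col) (auto simp: R_def M_def)
  also have "char_poly (0\<^sub>m 1 1 :: 'a mat) = [:0, 1:]"
    by (simp add: char_poly_defs det_def sign_def)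
  finally show ?thesis unfolding M_def .
qed

section \<open>The Laplacian as an operator on functions, and its second eigenvalue\<close>

definition graph_laplacian :: "'a pair_pre_digraph \<Rightarrow> ('a \<Rightarrow> real) \<Rightarrow> 'a \<Rightarrow> real" where
  "graph_laplacian G x u = (\<Sum>w | (u, w) \<in> parcs G. x u - x w)"

lemma (in pair_graph) arcs_sym: "(u, w) \<in> parcs G \<longleftrightarrow> (w, u) \<in> parcs G"
  using pair_sym_arcs by (auto simp: symmetric_def sym_def)

lemma (in pair_graph) sum_arcs_swap:
  fixes F :: "'a \<Rightarrow> 'a \<Rightarrow> real"
  shows "(\<Sum>u\<in>pverts G. \<Sum>w | (u, w) \<in> parcs G. F u w) =
    (\<Sum>u\<in>pverts G. \<Sum>w | (u, w) \<in> parcs G. F w u)"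
proof -
  have expand: "(\<Sum>w | (u, w) \<in> parcs G. H w) = (\<Sum>w\<in>pverts G. if (u, w) \<in> parcs G then H w else 0)"
    for u and H :: "'a \<Rightarrow> real"
  proof -
    have "{w. (u, w) \<in> parcs G} = {w \<in> pverts G. (u, w) \<in> parcs G}" by (auto dest: in_arcsD2)
    then show ?thesis using pair_finite_verts by (simp add: sum.inter_filter)
  qed
  show ?thesis unfolding expand
    by (subst sum.swap) (use arcs_sym in \<open>auto intro!: sum.cong\<close>)
qed

lemma (in pair_graph) sum_graph_laplacian: "(\<Sum>u\<in>pverts G. graph_laplacian G x u) = 0"
  using sum_arcs_swap[of "\<lambda>u w. x u"]
  by (simp add: graph_laplacian_def sum_subtractf)

text \<open>Summation by parts; each edge is visited in both directions, hence the factor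
  \<open>2\<close>.\<close>

lemma (in pair_graph) sum_mult_graph_laplacian:
  "(\<Sum>u\<in>pverts G. \<Sum>w | (u, w) \<in> parcs G. (x u - x w)\<^sup>2) =
    2 * (\<Sum>u\<in>pverts G. x u * graph_laplacian G x u)"
proof -
  have "(\<Sum>u\<in>pverts G. x u * graph_laplacian G x u) =
      (\<Sum>u\<in>pverts G. \<Sum>w | (u, w) \<in> parcs G. x u * (x u - x w))"
    by (simp add: graph_laplacian_def sum_distrib_left)
  moreover have "\<dots> = (\<Sum>u\<in>pverts G. \<Sum>w | (u, w) \<in> parcs G. x w * (x w - x u))"
    by (rule sum_arcs_swap)
  moreover have "(x u - x w)\<^sup>2 = x u * (x u - x w) + x w * (x w - x u)" for u w
    by (simp add: power2_eq_square algebra_simps)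
  ultimately show ?thesis by (simp add: sum.distrib)
qed

lemma (in pair_graph) laplacian_mat_row:
  assumes vs: "distinct vs" "set vs = pverts G" and i: "i < length vs"
  shows "(\<Sum>j<length vs. laplacian_mat G vs $$ (i, j) * x (vs ! j)) =
    graph_laplacian G x (vs ! i)"
proof -
  let ?u = "vs ! i"
  have bij: "bij_betw (nth vs) {..<length vs} (pverts G)"
    using bij_betw_nth[OF vs(1) refl] vs(2) by simp
  have deg: "out_degree (with_proj G) ?u = card {w. (?u, w) \<in> parcs G}"
  proof -
    have "out_arcs (with_proj G) ?u = Pair ?u ` {w. (?u, w) \<in> parcs G}"
      by (auto simp: out_arcs_def)
    then show ?thesis by (simp add: out_degree_def card_image inj_on_def)
  qed
  have "(\<Sum>j<length vs. laplacian_mat G vs $$ (i, j) * x (vs ! j)) =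
      (\<Sum>j<length vs. (if j = i then real (out_degree (with_proj G) ?u) * x ?u else 0) -
        (if (?u, vs ! j) \<in> parcs G then x (vs ! j) else 0))"
    using i by (intro sum.cong refl) (auto simp: laplacian_mat_def algebra_simps)
  also have "\<dots> = real (out_degree (with_proj G) ?u) * x ?u -
      (\<Sum>j<length vs. if (?u, vs ! j) \<in> parcs G then x (vs ! j) else 0)"
    using i by (simp add: sum_subtractf)
  also have "(\<Sum>j<length vs. if (?u, vs ! j) \<in> parcs G then x (vs ! j) else 0) =
      (\<Sum>w\<in>pverts G. if (?u, w) \<in> parcs G then x w else 0)"
    by (rule sum.reindex_bij_betw[OF bij])
  also have "\<dots> = (\<Sum>w | (?u, w) \<in> parcs G. x w)"
    using pair_finite_verts
    by (subst sum.inter_filter[symmetric]) (auto intro!: sum.cong dest: in_arcsD2)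
  finally show ?thesis by (simp add: graph_laplacian_def sum_subtractf deg)
qed

text \<open>The matrix \<open>M\<close> below is the Laplacian acting on functions modulo constants. Splitting off the factor
  \<open>X\<close> of the characteristic polynomial in this way avoids any diagonalisation.\<close>

lemma (in pair_graph) algebraic_connectivity_eqI:
  assumes "c \<ge> 0"
    and gap: "\<And>x :: 'a \<Rightarrow> real. (\<Sum>u\<in>pverts G. x u) = 0 \<Longrightarrow>
      2 * c * (\<Sum>u\<in>pverts G. (x u)\<^sup>2) \<le> (\<Sum>u\<in>pverts G. \<Sum>w | (u, w) \<in> parcs G. (x u - x w)\<^sup>2)"
    and ev: "\<And>u. u \<in> pverts G \<Longrightarrow> graph_laplacian G x u = c * x u"
    and nonconst: "p \<in> pverts G" "q \<in> pverts G" "x p \<noteq> x q"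
  shows "algebraic_connectivity G = c"
proof -
  obtain vs where vs: "distinct vs" "set vs = pverts G"
    using finite_distinct_list[OF pair_finite_verts] by blast
  have "vs \<noteq> []" using vs nonconst by auto
  then obtain m where len: "length vs = Suc m" by (cases vs) auto
  have bij: "bij_betw (nth vs) {..<Suc m} (pverts G)"
    using bij_betw_nth[OF vs(1) refl] vs(2) len by simp
  have in_verts: "vs ! i \<in> pverts G" if "i < Suc m" for i
    using that vs len by (metis nth_mem)
  have vertsE: thesis if "u \<in> pverts G" and "u = vs ! 0 \<Longrightarrow> thesis"
    and "\<And>i. i < m \<Longrightarrow> u = vs ! Suc i \<Longrightarrow> thesis" for u thesis
  proof -
    from that(1) obtain i where "i < Suc m" "u = vs ! i"
      using vs len by (metis in_set_conv_nth)
    then show thesis using that(2,3) by (cases i) auto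
  qed
  define L where "L = laplacian_mat G vs"
  define M where "M = mat m m (\<lambda>(i, j). L $$ (Suc i, Suc j) - L $$ (0, Suc j))"
  have L: "L \<in> carrier_mat (Suc m) (Suc m)" and M: "M \<in> carrier_mat m m"
    by (simp_all add: L_def laplacian_mat_def len M_def)
  have row: "(\<Sum>j<Suc m. L $$ (i, j) * z (vs ! j)) = graph_laplacian G z (vs ! i)"
    if "i < Suc m" for i z
    using laplacian_mat_row[OF vs] that by (simp add: L_def len del: sum.lessThan_Suc)
  have "(\<Sum>j<Suc m. L $$ (i, j)) = 0" if "i < Suc m" for i
    using row[OF that, of "\<lambda>_. 1"] by (simp add: graph_laplacian_def del: sum.lessThan_Suc)
  then have "char_poly L = [:0, 1:] * char_poly M"
    unfolding M_def by (rule char_poly_zero_row_sums[OF L])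
  moreover have M0: "char_poly M \<noteq> 0" using degree_monic_char_poly[OF M] by auto
  ultimately have "proots (char_poly L) = {#0#} + proots (char_poly M)"
    by (simp add: proots_mult del: mult_pCons_left)
  then have spectrum: "laplacian_spectrum G = insort 0 (sorted_list_of_multiset (proots (char_poly M)))"
    using laplacian_spectrum_enum[OF vs] by (simp add: L_def)
  \<comment> \<open>A class modulo constants is represented by its member vanishing at
    \<open>vs ! 0\<close>; \<open>M\<close> applies the Laplacian and normalises again.\<close>
  have M_row: "(M *\<^sub>v vec m (\<lambda>j. z (vs ! Suc j))) $ i =
      graph_laplacian G z (vs ! Suc i) - graph_laplacian G z (vs ! 0)"
    if i: "i < m" and z: "z (vs ! 0) = 0" for z i
  proof -
    have "(M *\<^sub>v vec m (\<lambda>j. z (vs ! Suc j))) $ i =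
        (\<Sum>j<m. (L $$ (Suc i, Suc j) - L $$ (0, Suc j)) * z (vs ! Suc j))"
      using i by (simp add: M_def scalar_prod_def atLeast0LessThan)
    also have "\<dots> = (\<Sum>j<Suc m. L $$ (Suc i, j) * z (vs ! j)) - (\<Sum>j<Suc m. L $$ (0, j) * z (vs ! j))"
      unfolding sum.lessThan_Suc_shift by (simp add: z sum_subtractf algebra_simps)
    also have "\<dots> = graph_laplacian G z (vs ! Suc i) - graph_laplacian G z (vs ! 0)"
      using i by (simp only: row Suc_less_eq zero_less_Suc)
    finally show ?thesis .
  qed
  have lap_shift: "graph_laplacian G (\<lambda>u. z u - s) u = graph_laplacian G z u" for z s u
    by (simp add: graph_laplacian_def)
  have c_root: "eigenvalue M c"
  proof -
    let ?z = "\<lambda>u. x u - x (vs ! 0)"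
    let ?y = "vec m (\<lambda>j. ?z (vs ! Suc j))"
    have "M *\<^sub>v ?y = c \<cdot>\<^sub>v ?y"
    proof (rule eq_vecI)
      fix i assume "i < dim_vec (c \<cdot>\<^sub>v ?y)"
      then have i: "i < m" by simp
      then show "(M *\<^sub>v ?y) $ i = (c \<cdot>\<^sub>v ?y) $ i"
        using M_row[of i ?z] ev in_verts[of "Suc i"] in_verts[of 0]
        by (simp add: lap_shift algebra_simps)
    qed (use M in auto)
    moreover have "?y \<noteq> 0\<^sub>v m"
    proof
      assume y0: "?y = 0\<^sub>v m"
      have z0: "?z u = 0" if "u \<in> pverts G" for u
      proof (rule vertsE[OF that])
        fix i assume "i < m" "u = vs ! Suc i"
        then show "?z u = 0" using arg_cong[OF y0, of "\<lambda>v. v $ i"] by simp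
      qed simp
      show False using z0[OF nonconst(1)] z0[OF nonconst(2)] nonconst(3) by simp
    qed
    ultimately have "eigenvector M ?y c" using M by (simp add: eigenvector_def)
    then show ?thesis by (auto simp: eigenvalue_def)
  qed
  \<comment> \<open>An eigenvector of \<open>M\<close> lifts to a function \<open>z\<close>
    satisfying the eigenvalue equation up to a constant \<open>t\<close>. Subtracting the mean
    \<open>s\<close> removes the constant, because Laplacian values sum to zero, and makes the gap
    applicable.\<close>
  have roots_ge: "c \<le> \<mu>" if ev\<mu>: "eigenvalue M \<mu>" for \<mu>
  proof -
    from ev\<mu> obtain y where y: "y \<in> carrier_vec m" "y \<noteq> 0\<^sub>v m" "M *\<^sub>v y = \<mu> \<cdot>\<^sub>v y"
      using M unfolding eigenvalue_def eigenvector_def by auto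
    define z where "z u = (case the_inv_into {..<Suc m} (nth vs) u of 0 \<Rightarrow> 0 | Suc i \<Rightarrow> y $ i)" for u
    have inv: "the_inv_into {..<Suc m} (nth vs) (vs ! i) = i" if "i < Suc m" for i
      using that bij by (intro the_inv_into_f_f) (auto simp: bij_betw_def)
    have z0: "z (vs ! 0) = 0" and zS: "i < m \<Longrightarrow> z (vs ! Suc i) = y $ i" for i
      by (simp_all add: z_def inv)
    have y_eq: "vec m (\<lambda>j. z (vs ! Suc j)) = y"
      using y(1) by (intro eq_vecI) (auto simp: zS)
    define t where "t = graph_laplacian G z (vs ! 0)"
    have lap_z: "graph_laplacian G z u = \<mu> * z u + t" if "u \<in> pverts G" for u
    proof (rule vertsE[OF that])
      fix i assume i: "i < m" "u = vs ! Suc i"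
      then show "graph_laplacian G z u = \<mu> * z u + t"
        using M_row[of i z] z0 y by (simp add: y_eq t_def zS)
    qed (simp add: t_def z0)
    let ?n = "real (card (pverts G))"
    define s where "s = (\<Sum>u\<in>pverts G. z u) / ?n"
    have n: "?n > 0" using nonconst(1) pair_finite_verts by (auto simp: card_gt_0_iff)
    have "\<mu> * (\<Sum>u\<in>pverts G. z u) + ?n * t = 0"
      using sum_graph_laplacian[of z] by (simp add: lap_z sum.distrib sum_distrib_left)
    then have "?n * (\<mu> * s + t) = 0" using n by (simp add: s_def algebra_simps)
    then have st: "\<mu> * s + t = 0" using n by (metis mult_eq_0_iff less_irrefl)
    define z' where "z' u = z u - s" for u
    have lap_z': "graph_laplacian G z' u = \<mu> * z' u" if "u \<in> pverts G" for u
      unfolding z'_def lap_shift lap_z[OF that] using st by (simp add: algebra_simps)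
    have "(\<Sum>u\<in>pverts G. z' u) = 0"
      using n by (simp add: z'_def s_def sum_subtractf)
    from gap[OF this] have "2 * c * (\<Sum>u\<in>pverts G. (z' u)\<^sup>2) \<le> 2 * (\<Sum>u\<in>pverts G. z' u * (\<mu> * z' u))"
      by (simp add: sum_mult_graph_laplacian lap_z')
    moreover have "(\<Sum>u\<in>pverts G. z' u * (\<mu> * z' u)) = \<mu> * (\<Sum>u\<in>pverts G. (z' u)\<^sup>2)"
      by (simp add: sum_distrib_left power2_eq_square mult_ac)
    ultimately have le: "c * (\<Sum>u\<in>pverts G. (z' u)\<^sup>2) \<le> \<mu> * (\<Sum>u\<in>pverts G. (z' u)\<^sup>2)"
      by simp
    \<comment> \<open>Otherwise \<open>z\<close> is constant, hence zero by its value at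
      \<open>vs ! 0\<close>, contradicting \<open>y \<noteq> 0\<close>.\<close>
    have "(\<Sum>u\<in>pverts G. (z' u)\<^sup>2) \<noteq> 0"
    proof
      assume "(\<Sum>u\<in>pverts G. (z' u)\<^sup>2) = 0"
      then have eq: "z u = s" if "u \<in> pverts G" for u
        using that pair_finite_verts by (simp add: sum_nonneg_eq_0_iff z'_def)
      have "s = 0" using eq[OF in_verts[of 0]] z0 by simp
      then have "y = 0\<^sub>v m"
        using y(1) eq[OF in_verts] zS by (intro eq_vecI) auto
      then show False using y(2) by simp
    qed
    then have "(\<Sum>u\<in>pverts G. (z' u)\<^sup>2) > 0" by (simp add: sum_nonneg less_le)
    then show ?thesis using le by simp
  qed
  define R where "R = sorted_list_of_multiset (proots (char_poly M))"
  have set_R: "set R = {\<mu>. eigenvalue M \<mu>}"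
    unfolding R_def by (simp add: M0 eigenvalue_root_char_poly[OF M])
  have "R \<noteq> []" using c_root set_R by auto
  then obtain e es where R: "R = e # es" by (cases R) auto
  have "sorted R" by (simp add: R_def)
  then have "e \<le> c" using c_root set_R R by (auto)
  moreover have "c \<le> e" using roots_ge set_R R by auto
  ultimately have "e = c" by simp
  \<comment> \<open>The root \<open>0\<close> that was split off comes first since
    \<open>c \<ge> 0\<close>, so index \<open>1\<close> of the spectrum is the head of
    \<open>R\<close>.\<close>
  moreover have "insort 0 R = 0 # R"
    using \<open>c \<ge> 0\<close> \<open>e = c\<close> R by (cases R) auto
  ultimately show ?thesis
    unfolding algebraic_connectivity_def spectrum R_def[symmetric] by (simp add: R)
qed

section \<open>Token graphs of joins with a clique\<close>

lemma card_Diff_eq_card_Diff: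
  assumes "finite S" "finite T" "card S = card T"
  shows "card (S - T) = card (T - S)"
  using assms card_Int_Diff[of S T] card_Int_Diff[of T S] by (simp add: Int_commute)

text \<open>Turns adjacency by symmetric difference into token moves. The move is recovered from its
  result \<open>T\<close>, as \<open>S - T = {a}\<close> and \<open>T - S = {b}\<close>.\<close>

lemma (in pair_graph) token_graph_neighbours:
  assumes S: "S \<subseteq> pverts G" "card S = k"
  shows "bij_betw (\<lambda>(a, b). insert b (S - {a})) {p \<in> S \<times> (pverts G - S). p \<in> parcs G}
    {T. (S, T) \<in> parcs (token_graph k G)}"
proof -
  have fin: "finite S" using S(1) pair_finite_verts finite_subset by blast
  have diffs: "S - insert b (S - {a}) = {a}" "insert b (S - {a}) - S = {b}"
    if "a \<in> S" "b \<notin> S" for a b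
    using that by auto
  show ?thesis
  proof (rule bij_betwI')
    fix p q assume "p \<in> {p \<in> S \<times> (pverts G - S). p \<in> parcs G}"
      "q \<in> {p \<in> S \<times> (pverts G - S). p \<in> parcs G}"
    then obtain a b c d where pq: "p = (a, b)" "q = (c, d)" "a \<in> S" "b \<notin> S" "c \<in> S" "d \<notin> S"
      by auto
    have "a = c \<and> b = d" if "insert b (S - {a}) = insert d (S - {c})"
      using diffs[OF pq(3,4)] diffs[OF pq(5,6)] that by simp
    then show "((\<lambda>(a, b). insert b (S - {a})) p = (\<lambda>(a, b). insert b (S - {a})) q) = (p = q)"
      using pq by auto
  next
    fix p assume "p \<in> {p \<in> S \<times> (pverts G - S). p \<in> parcs G}"
    then obtain a b where p: "p = (a, b)" "a \<in> S" "b \<in> pverts G" "b \<notin> S" "(a, b) \<in> parcs G"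
      by auto
    have "card (insert b (S - {a})) = k"
      using fin p S(2) by (simp add: card_Suc_Diff1 del: card_Diff_insert)
    moreover have "(S - insert b (S - {a})) \<union> (insert b (S - {a}) - S) = {a, b}"
      using p by auto
    ultimately show "(\<lambda>(a, b). insert b (S - {a})) p \<in> {T. (S, T) \<in> parcs (token_graph k G)}"
      using p S by (auto simp: token_graph_def)
  next
    fix T assume "T \<in> {T. (S, T) \<in> parcs (token_graph k G)}"
    then obtain a b where T: "T \<subseteq> pverts G" "card T = k"
      and ab: "(S - T) \<union> (T - S) = {a, b}" "(a, b) \<in> parcs G"
      by (auto simp: token_graph_def)
    have finT: "finite T" using T(1) pair_finite_verts finite_subset by blast
    \<comment> \<open>The two differences have equal size and together two elements, hence one each.
      The pair \<open>(c, d)\<close> may be \<open>(a, b)\<close> or \<open>(b, a)\<close>, so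
      symmetry of the arcs is needed.\<close>
    have "a \<noteq> b" using pair_no_loops[OF ab(2)] by simp
    moreover have "(S - T) \<inter> (T - S) = {}" by auto
    ultimately have "card (S - T) + card (T - S) = 2"
      using card_Un_disjoint[of "S - T" "T - S"] fin finT ab(1) by simp
    then have "card (S - T) = 1" "card (T - S) = 1"
      using card_Diff_eq_card_Diff[OF fin finT] S(2) T(2) by auto
    then obtain c d where cd: "S - T = {c}" "T - S = {d}"
      by (metis card_1_singletonE)
    then have "{c, d} = {a, b}" using ab(1) by auto
    then have "(c, d) \<in> parcs G" using ab(2) arcs_sym[of a b] by (auto simp: doubleton_eq_iff)
    moreover have "c \<in> S" "d \<in> pverts G - S" "T = insert d (S - {c})"
      using cd T by auto
    ultimately show "\<exists>p\<in>{p \<in> S \<times> (pverts G - S). p \<in> parcs G}. T = (\<lambda>(a, b). insert b (S - {a})) p"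
      by (intro bexI[of _ "(c, d)"]) auto
  qed
qed

lemma (in pair_graph) sum_token_graph_neighbours:
  fixes F :: "'a set \<Rightarrow> real"
  assumes S: "S \<subseteq> pverts G" "card S = k"
  shows "(\<Sum>T | (S, T) \<in> parcs (token_graph k G). F T) =
    (\<Sum>a\<in>S. \<Sum>b\<in>pverts G - S. if (a, b) \<in> parcs G then F (insert b (S - {a})) else 0)"
proof -
  have fin: "finite S" using S(1) pair_finite_verts finite_subset by blast
  have "(\<Sum>T | (S, T) \<in> parcs (token_graph k G). F T) =
      (\<Sum>p\<in>{p \<in> S \<times> (pverts G - S). p \<in> parcs G}. F ((\<lambda>(a, b). insert b (S - {a})) p))"
    by (rule sum.reindex_bij_betw[OF token_graph_neighbours[OF S], symmetric])
  also have "\<dots> = (\<Sum>p\<in>S \<times> (pverts G - S).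
      if p \<in> parcs G then F ((\<lambda>(a, b). insert b (S - {a})) p) else 0)"
    using fin pair_finite_verts by (intro sum.inter_filter) auto
  also have "\<dots> = (\<Sum>(a, b)\<in>S \<times> (pverts G - S).
      if (a, b) \<in> parcs G then F (insert b (S - {a})) else 0)"
    by (rule sum.cong) auto
  finally show ?thesis by (simp add: sum.cartesian_product)
qed

lemma (in pair_graph) token_graph_gap:
  assumes gap: "token_gap (pverts G) (parcs G) c"
    and x: "(\<Sum>S\<in>pverts (token_graph k G). x S) = 0"
  shows "2 * c * (\<Sum>S\<in>pverts (token_graph k G). (x S)\<^sup>2) \<le>
    (\<Sum>S\<in>pverts (token_graph k G). \<Sum>T | (S, T) \<in> parcs (token_graph k G). (x S - x T)\<^sup>2)"
proof -
  let ?V = "pverts G"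
  \<comment> \<open>Extended by zero, \<open>x\<close> is balanced on every level, and only moves on
    level \<open>k\<close> contribute energy.\<close>
  define f where "f S = (if card S = k then x S else 0)" for S
  have verts: "pverts (token_graph k G) = {S \<in> Pow ?V. card S = k}"
    by (auto simp: token_graph_def)
  have fin: "finite (Pow ?V)" using pair_finite_verts by simp
  have fin': "finite S" if "S \<in> Pow ?V" for S
    using that pair_finite_verts finite_subset by blast
  have "(\<Sum>S\<in>{S \<in> Pow ?V. card S = j}. f S) = 0" for j
  proof (cases "j = k")
    case True
    have "(\<Sum>S\<in>{S \<in> Pow ?V. card S = j}. f S) = (\<Sum>S\<in>{S \<in> Pow ?V. card S = k}. x S)"
      using True by (intro sum.cong) (auto simp: f_def)
    then show ?thesis using x verts by simp
  next
    case False
    then show ?thesis by (intro sum.neutral) (auto simp: f_def)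
  qed
  then have "level_balanced ?V f" by (simp only: level_balanced_def) blast
  then have "2 * c * (\<Sum>S\<in>Pow ?V. (f S)\<^sup>2) \<le> token_energy ?V (parcs G) f"
    using gap by (simp add: token_gap_def)
  also have "(\<Sum>S\<in>Pow ?V. (f S)\<^sup>2) = (\<Sum>S\<in>pverts (token_graph k G). (x S)\<^sup>2)"
    unfolding verts sum.inter_filter[OF fin] by (rule sum.cong) (auto simp: f_def)
  also have "token_energy ?V (parcs G) f =
    (\<Sum>S\<in>pverts (token_graph k G). \<Sum>T | (S, T) \<in> parcs (token_graph k G). (x S - x T)\<^sup>2)"
    unfolding verts sum.inter_filter[OF fin] token_energy_def
  proof (rule sum.cong[OF refl])
    fix S assume S: "S \<in> Pow ?V"
    have "card (insert b (S - {a})) = card S" if "a \<in> S" "b \<in> ?V - S" for a b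
      using that fin'[OF S] by (simp add: card_Suc_Diff1 del: card_Diff_insert)
    then have "(\<Sum>a\<in>S. \<Sum>b\<in>?V - S. if (a, b) \<in> parcs G then (f S - f (insert b (S - {a})))\<^sup>2 else 0) =
        (\<Sum>a\<in>S. \<Sum>b\<in>?V - S. if card S = k then
          (if (a, b) \<in> parcs G then (x S - x (insert b (S - {a})))\<^sup>2 else 0) else 0)"
      by (intro sum.cong refl) (auto simp: f_def)
    then show "(\<Sum>a\<in>S. \<Sum>b\<in>?V - S. if (a, b) \<in> parcs G then (f S - f (insert b (S - {a})))\<^sup>2 else 0) =
        (if card S = k then \<Sum>T | (S, T) \<in> parcs (token_graph k G). (x S - x T)\<^sup>2 else 0)"
      using S by (simp add: sum_token_graph_neighbours)
  qed
  finally show ?thesis .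
qed

text \<open>Moving a token from \<open>a\<close> to \<open>b\<close> lowers the sum by
  \<open>x a - x b\<close>. The arcs inside \<open>S\<close>, absent on the left, contribute
  antisymmetric terms on the right, which cancel.\<close>

lemma (in pair_graph) graph_laplacian_token_graph:
  assumes S: "S \<in> pverts (token_graph k G)"
  shows "graph_laplacian (token_graph k G) (\<lambda>S. \<Sum>v\<in>S. x v) S = (\<Sum>a\<in>S. graph_laplacian G x a)"
proof -
  have S': "S \<subseteq> pverts G" "card S = k" using S by (auto simp: token_graph_def)
  have fin: "finite S" using S'(1) pair_finite_verts finite_subset by blast
  define d where "d a b = (if (a, b) \<in> parcs G then x a - x b else 0)" for a b
  have "(\<Sum>a\<in>S. \<Sum>b\<in>S. d a b) = (\<Sum>b\<in>S. \<Sum>a\<in>S. d a b)" by (rule sum.swap)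
  also have "\<dots> = - (\<Sum>b\<in>S. \<Sum>a\<in>S. d b a)"
    unfolding sum_negf[symmetric] by (intro sum.cong refl) (use arcs_sym in \<open>auto simp: d_def\<close>)
  finally have inner: "(\<Sum>a\<in>S. \<Sum>b\<in>S. d a b) = 0" by simp
  have lap: "graph_laplacian G x a = (\<Sum>b\<in>S. d a b) + (\<Sum>b\<in>pverts G - S. d a b)" for a
  proof -
    have "graph_laplacian G x a = (\<Sum>b\<in>{b \<in> pverts G. (a, b) \<in> parcs G}. x a - x b)"
      unfolding graph_laplacian_def by (rule sum.cong) (auto dest: in_arcsD2)
    also have "\<dots> = (\<Sum>b\<in>pverts G. d a b)"
      unfolding d_def using pair_finite_verts by (rule sum.inter_filter)
    finally show ?thesis
      using sum.subset_diff[OF S'(1) pair_finite_verts, of "d a"] by simp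
  qed
  have "graph_laplacian (token_graph k G) (\<lambda>S. \<Sum>v\<in>S. x v) S = (\<Sum>a\<in>S. \<Sum>b\<in>pverts G - S. d a b)"
    unfolding graph_laplacian_def sum_token_graph_neighbours[OF S']
  proof (intro sum.cong refl)
    fix a b assume ab: "a \<in> S" "b \<in> pverts G - S"
    then have "(\<Sum>v\<in>insert b (S - {a}). x v) = x b + ((\<Sum>v\<in>S. x v) - x a)"
      using fin by (simp add: sum_diff1)
    then show "(if (a, b) \<in> parcs G then sum x S - sum x (insert b (S - {a})) else 0) = d a b"
      by (simp add: d_def)
  qed
  then show ?thesis by (simp add: lap sum.distrib inner)
qed

text \<open>Enumerating the singletons in the order of the vertices makes the two Laplacian matrices
  equal. This lets the case \<open>k = 1\<close> speak about \<open>G\<close> itself.\<close>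

lemma (in pair_graph) algebraic_connectivity_token_graph_one:
  "algebraic_connectivity (token_graph 1 G) = algebraic_connectivity G"
proof -
  let ?T = "token_graph 1 G"
  obtain vs where vs: "distinct vs" "set vs = pverts G"
    using finite_distinct_list[OF pair_finite_verts] by blast
  have verts: "pverts ?T = (\<lambda>v. {v}) ` pverts G"
    by (auto simp: token_graph_def card_1_singleton_iff)
  have ws: "distinct (map (\<lambda>v. {v}) vs)" "set (map (\<lambda>v. {v}) vs) = pverts ?T"
    using vs verts by (auto simp: distinct_map inj_on_def)
  have sym_diff: "({u} - {w}) \<union> ({w} - {u}) = (if u = w then {} else {u, w})" for u w :: 'a
    by auto
  have arcs: "({u}, {w}) \<in> parcs ?T \<longleftrightarrow> (u, w) \<in> parcs G" for u w
    using in_arcsD1[of u w] in_arcsD2[of u w] arcs_sym[of u w] pair_no_loops[of "(u, w)"]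
    unfolding token_graph_def by (auto simp: sym_diff doubleton_eq_iff split: if_splits)
  have deg: "out_degree (with_proj ?T) {u} = out_degree (with_proj G) u" for u
  proof -
    have "out_arcs (with_proj ?T) {u} = (\<lambda>(a, b). ({a}, {b})) ` out_arcs (with_proj G) u"
    proof (intro equalityI subsetI)
      fix e assume "e \<in> out_arcs (with_proj ?T) {u}"
      then obtain S where e: "e = ({u}, S)" "({u}, S) \<in> parcs ?T"
        by (cases e) (auto simp: out_arcs_def)
      then obtain w where "S = {w}" by (auto simp: token_graph_def card_1_singleton_iff)
      then show "e \<in> (\<lambda>(a, b). ({a}, {b})) ` out_arcs (with_proj G) u"
        using e arcs by (auto simp: out_arcs_def intro!: image_eqI[of _ _ "(u, w)"])
    qed (use arcs in \<open>auto simp: out_arcs_def\<close>)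
    then show ?thesis
      by (simp only: out_degree_def) (rule card_image, auto simp: inj_on_def)
  qed
  have "laplacian_mat ?T (map (\<lambda>v. {v}) vs) = laplacian_mat G vs"
    unfolding laplacian_mat_def length_map using deg arcs
    by (intro cong_mat refl) (simp del: One_nat_def)
  then show ?thesis
    by (simp only: algebraic_connectivity_def laplacian_spectrum_enum[OF ws] laplacian_spectrum_enum[OF vs])
qed

section \<open>The eigenvector for a join with a clique, and the theorem\<close>

lemma (in pair_graph) algebraic_connectivity_token_graph_join:
  assumes partition: "pverts G = K \<union> A \<union> B" "K \<inter> A = {}" "K \<inter> B = {}" "A \<inter> B = {}"
    and nonempty: "A \<noteq> {}" "B \<noteq> {}"
    and universal: "\<And>u w. u \<in> K \<Longrightarrow> w \<in> pverts G \<Longrightarrow> u \<noteq> w \<Longrightarrow> (u, w) \<in> parcs G"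
    and separated: "\<And>u w. u \<in> A \<Longrightarrow> w \<in> B \<Longrightarrow> (u, w) \<notin> parcs G"
    and k: "1 \<le> k" "k < card (pverts G)"
  shows "algebraic_connectivity (token_graph k G) = card K"
proof -
  let ?V = "pverts G" and ?T = "token_graph k G"
  have fin: "finite ?V" "finite K" "finite A" "finite B"
    using pair_finite_verts partition(1) by auto
  have "pair_graph ?T"
    by (rule pair_graph_token_graph) (rule pair_graph_axioms)
  then interpret T: pair_graph ?T .
  \<comment> \<open>\<open>x\<close> is a Laplacian eigenvector of \<open>G\<close> for \<open>card K\<close>; its sums over \<open>k\<close>-subsets form one of the
    token graph.\<close>
  define x where "x v = (if v \<in> A then real (card B) else if v \<in> B then - real (card A) else 0)" for v
  have x_K: "x v = 0" if "v \<in> K" for v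
    using that partition by (auto simp: x_def)
  have sum_x: "(\<Sum>v\<in>?V. x v) = 0"
  proof -
    have "(\<Sum>v\<in>?V. x v) = (\<Sum>v\<in>K. x v) + (\<Sum>v\<in>A. x v) + (\<Sum>v\<in>B. x v)"
      unfolding partition(1) using fin partition
      by (subst sum.union_disjoint; auto)+
    also have "(\<Sum>v\<in>K. x v) = 0" by (simp add: x_K)
    also have "(\<Sum>v\<in>A. x v) = (\<Sum>v\<in>A. real (card B))" by (rule sum.cong) (auto simp: x_def)
    also have "(\<Sum>v\<in>B. x v) = (\<Sum>v\<in>B. - real (card A))"
      using partition by (intro sum.cong) (auto simp: x_def)
    finally show ?thesis by simp
  qed
  have lap_x: "graph_laplacian G x v = real (card K) * x v" if v: "v \<in> ?V" for v
  proof -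
    have "graph_laplacian G x v = (\<Sum>w\<in>{w \<in> ?V. (v, w) \<in> parcs G}. x v - x w)"
      unfolding graph_laplacian_def by (rule sum.cong) (auto dest: in_arcsD2)
    also have "\<dots> = (\<Sum>w\<in>?V. if (v, w) \<in> parcs G then x v - x w else 0)"
      using fin(1) by (rule sum.inter_filter)
    also have "\<dots> = real (card K) * x v"
    proof (cases "v \<in> K")
      case True
      have "(\<Sum>w\<in>?V. if (v, w) \<in> parcs G then x v - x w else 0) = (\<Sum>w\<in>?V. - x w)"
        using True universal x_K by (intro sum.cong refl) auto
      then show ?thesis using True by (simp add: sum_negf sum_x x_K)
    next
      case False
      \<comment> \<open>Outside \<open>K\<close> all neighbours of \<open>v\<close> lie on its own
        side, where \<open>x\<close> has the same value; each vertex of \<open>K\<close> is a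
        neighbour with value \<open>0\<close>.\<close>
      have "(if (v, w) \<in> parcs G then x v - x w else 0) = (if w \<in> K then x v else 0)"
        if w: "w \<in> ?V" for w
      proof (cases "w \<in> K")
        case True
        then have "(v, w) \<in> parcs G" using universal[of w v] v False arcs_sym by auto
        then show ?thesis using True by (simp add: x_K)
      next
        case wK: False
        have "v \<in> A \<and> w \<in> A \<or> v \<in> B \<and> w \<in> B" if "(v, w) \<in> parcs G"
          using that separated arcs_sym v w False wK partition(1) by blast
        then show ?thesis using wK partition(4) by (auto simp: x_def)
      qed
      then have "(\<Sum>w\<in>?V. if (v, w) \<in> parcs G then x v - x w else 0) =
          (\<Sum>w\<in>?V. if w \<in> K then x v else 0)"
        by (rule sum.cong[OF refl])
      also have "\<dots> = (\<Sum>w\<in>{w \<in> ?V. w \<in> K}. x v)"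
        using fin(1) by (rule sum.inter_filter[symmetric])
      also have "{w \<in> ?V. w \<in> K} = K" using partition(1) by auto
      finally show ?thesis by simp
    qed
    finally show ?thesis .
  qed
  obtain a b where ab: "a \<in> A" "b \<in> B" using nonempty by auto
  then have ab': "a \<noteq> b" "a \<in> ?V" "b \<in> ?V" using partition by auto
  \<comment> \<open>Placing the other \<open>k - 1\<close> tokens on a common set \<open>R\<close>
    yields two vertices of the token graph whose sums differ by \<open>x a - x b\<close>; there is
    room because \<open>k < card ?V\<close>.\<close>
  have "k - 1 \<le> card (?V - {a, b})" using ab' fin k by (simp add: card_Diff_subset)
  then obtain R where R: "R \<subseteq> ?V - {a, b}" "card R = k - 1" "finite R"
    by (rule obtain_subset_with_card_n)
  have inv: "insert u R \<in> pverts ?T" "sum x (insert u R) = x u + sum x R" if "u \<in> {a, b}" for u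
  proof -
    have "u \<notin> R" using that R(1) by auto
    then show "insert u R \<in> pverts ?T" "sum x (insert u R) = x u + sum x R"
      using R ab' k that by (auto simp: token_graph_def)
  qed
  show ?thesis
  proof (rule T.algebraic_connectivity_eqI[where x = "sum x" and p = "insert a R" and q = "insert b R"])
    show "0 \<le> real (card K)" by simp
    have "token_gap ?V (parcs G) (real (card K))"
      using fin partition universal arcs_sym by (intro token_gap_universal_vertices) auto
    then show "2 * real (card K) * (\<Sum>S\<in>pverts ?T. (y S)\<^sup>2) \<le>
        (\<Sum>S\<in>pverts ?T. \<Sum>T | (S, T) \<in> parcs ?T. (y S - y T)\<^sup>2)"
      if "(\<Sum>S\<in>pverts ?T. y S) = 0" for y
      using that by (rule token_graph_gap)
    show "graph_laplacian ?T (sum x) S = real (card K) * sum x S" if "S \<in> pverts ?T" for S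
    proof -
      have "S \<subseteq> ?V" using that by (auto simp: token_graph_def)
      then show ?thesis
        using graph_laplacian_token_graph[OF that, of x]
        by (simp add: sum_distrib_left lap_x subset_iff)
    qed
    have "card A > 0" "card B > 0" using nonempty fin by (auto simp: card_gt_0_iff)
    then have "x b < x a"
      using ab partition by (auto simp: x_def)
    then show "sum x (insert a R) \<noteq> sum x (insert b R)" using inv by simp
  qed (use inv in auto)
qed

theorem theorem5p3:
  fixes G C :: "'a pair_pre_digraph"
    and H :: "nat \<Rightarrow> 'a pair_pre_digraph"
    and n r s k :: nat
  assumes "pair_graph G"
    and "card (pverts G) = n"
    and "induced_subgraph (with_proj C) (with_proj G)"
    and "complete_digraph r (with_proj C)"
    and "s \<ge> 2"
    and "\<And>i. i \<in> {1..s} \<Longrightarrow> pair_graph (H i)"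
    and "\<And>i. i \<in> {1..s} \<Longrightarrow> pverts (H i) \<noteq> {}"
    and "\<And>i j. i \<in> {1..s} \<Longrightarrow> j \<in> {1..s} \<Longrightarrow> i \<noteq> j \<Longrightarrow> pverts (H i) \<inter> pverts (H j) = {}"
    and "with_proj G \<restriction> (pverts G - pverts C) =
           pre_digraph.Union (with_proj G) ((\<lambda>i. with_proj (H i)) ` {1..s})"
    and "boundary_edges G C = r * (n - r)"
    and "k \<in> {1..n - 1}"
  shows "algebraic_connectivity G = algebraic_connectivity (token_graph k G) \<and>
         algebraic_connectivity (token_graph k G) = real r"
proof -
  interpret pair_graph G by fact
  let ?V = "pverts G" and ?K = "pverts C"
  define A where "A = pverts (H 1)"
  define B where "B = (\<Union>i\<in>{2..s}. pverts (H i))"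
  have KV: "?K \<subseteq> ?V"
    using assms(3) by (auto simp: induced_subgraph_def subgraph_def)
  have finK: "finite ?K" using KV pair_finite_verts finite_subset by blast
  have arcsC: "parcs C \<subseteq> parcs G"
    using assms(3) by (auto simp: induced_subgraph_def)
  have cardK: "card ?K = r"
    using assms(4) by (simp add: complete_digraph_def)
  have arcs_ends_C: "arcs_ends (with_proj C) = parcs C"
    by (auto simp: arcs_ends_def arc_to_ends_def)
  have inK: "(u, w) \<in> parcs G" if "u \<in> ?K" "w \<in> ?K" "u \<noteq> w" for u w
    using assms(4) that arcsC unfolding complete_digraph_def arcs_ends_C by auto
  \<comment> \<open>The boundary arcs form a subset of this product, and the hypothesis gives them
    its cardinality, so every arc leaving \<open>?K\<close> is present.\<close>
  have "{(u, v). (u, v) \<in> parcs G \<and> u \<in> ?K \<and> v \<in> ?V - ?K} = ?K \<times> (?V - ?K)"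
  proof (rule card_subset_eq)
    show "finite (?K \<times> (?V - ?K))" using finK pair_finite_verts by simp
    show "card {(u, v). (u, v) \<in> parcs G \<and> u \<in> ?K \<and> v \<in> ?V - ?K} = card (?K \<times> (?V - ?K))"
      using assms(2,10) KV finK cardK
      by (simp add: boundary_edges_def card_cartesian_product card_Diff_subset)
  qed auto
  then have outK: "(u, w) \<in> parcs G" if "u \<in> ?K" "w \<in> ?V - ?K" for u w
    using that by blast
  have set_split: "{1..s} = insert 1 {2..s}" using assms(5) by auto
  have union_verts: "?V - ?K = A \<union> B"
  proof -
    have "?V - ?K = (\<Union>i\<in>{1..s}. pverts (H i))"
      using arg_cong[OF assms(9), of verts] by (simp add: pre_digraph.Union_def)
    then show ?thesis unfolding set_split A_def B_def by simp
  qed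
  have union_arcs: "{e \<in> parcs G. fst e \<in> ?V - ?K \<and> snd e \<in> ?V - ?K} = (\<Union>i\<in>{1..s}. parcs (H i))"
    using arg_cong[OF assms(9), of arcs] by (simp add: pre_digraph.Union_def induce_subgraph_def)
  have AB: "A \<inter> B = {}"
    using assms(5) assms(8)[of 1] by (auto simp: A_def B_def disjoint_iff)
  \<comment> \<open>An arc avoiding \<open>?K\<close> belongs to a single \<open>H i\<close>, so
    both its ends lie in that \<open>H i\<close>, whereas \<open>A\<close> and \<open>B\<close>
    consist of different ones.\<close>
  have separated: "(u, w) \<notin> parcs G" if "u \<in> A" "w \<in> B" for u w
  proof
    assume "(u, w) \<in> parcs G"
    then have "(u, w) \<in> {e \<in> parcs G. fst e \<in> ?V - ?K \<and> snd e \<in> ?V - ?K}"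
      using that union_verts by auto
    then obtain i where i: "i \<in> {1..s}" "(u, w) \<in> parcs (H i)"
      unfolding union_arcs by auto
    interpret Hi: pair_graph "H i" using assms(6) i(1) .
    have "u \<in> pverts (H i)" "w \<in> pverts (H i)"
      using i(2) Hi.in_arcsD1 Hi.in_arcsD2 by auto
    then show False
      using that AB i(1) assms(5) assms(8)[of 1 i] unfolding A_def B_def set_split by auto
  qed
  have main: "algebraic_connectivity (token_graph j G) = real r" if "1 \<le> j" "j < card ?V" for j
    unfolding cardK[symmetric]
  proof (rule algebraic_connectivity_token_graph_join[of _ A B])
    show "?V = ?K \<union> A \<union> B" "?K \<inter> A = {}" "?K \<inter> B = {}" using KV union_verts by auto
    show "A \<noteq> {}" "B \<noteq> {}"
      using assms(5) assms(7)[of 1] assms(7)[of 2] by (auto simp: A_def B_def)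
    show "(u, w) \<in> parcs G" if "u \<in> ?K" "w \<in> ?V" "u \<noteq> w" for u w
      using that inK outK by (cases "w \<in> ?K") auto
  qed (use AB separated that in auto)
  \<comment> \<open>The value for \<open>G\<close> is the case \<open>j = 1\<close>, admissible
    because the range of \<open>k\<close> forces \<open>n \<ge> 2\<close>.\<close>
  show ?thesis
    using main[of 1] main[of k] assms(2,11) algebraic_connectivity_token_graph_one by auto
qed

end
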